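(* Let $\mathcal{A}$ be a free ideal ring and $Q\in\mathrm{Mat}_{k\times m}(\mathcal{A})$. If $R_Q\le M\le\mathcal{A}^k$ (right submodules), then the double $Q$-dual $(M^{*Q})^{*Q}$ is the algebraic closure of $R_Q$ in $M$. Similarly, if $L_Q\le N\le\mathcal{A}^m$ (left submodules), then the double $Q$-dual $(N^{*Q})^{*Q}$ is the algebraic closure of $L_Q$ in $N$. Namely, $$R_Q\le_{\mathrm{alg}}(M^{*Q})^{*Q}\le_* M\quad\text{and}\quad L_Q\le_{\mathrm{alg}}(N^{*Q})^{*Q}\le_* N.$$
   Context: A free ideal ring (FIR) is a ring $\mathcal{A}$ all of whose one-sided ideals are free as $\mathcal{A}$-modules, of well-defined rank; then every submodule of a free (left or right) $\mathcal{A}$-module is free, of well-defined rank, denoted $\mathrm{rk}$. For a free $\mathcal{A}$-module $N$ and a submodule $M\le N$: $M$ is a free factor of $N$, written $M\le_* N$, if a basis of $M$ can be extended to a basis of $N$; the extension is algebraic, written $M\le_{\mathrm{alg}}N$, if there is no free factor $L$ of $N$ with $M\le L\subsetneq N$. If at least one of $M,N$ has finite rank, the algebraic closure of $M\le N$ is the unique submodule $L$ with $M\le_{\mathrm{alg}}L\le_* N$. $\mathcal{A}^k$ is the right $\mathcal{A}$-module of column vectors of length $k$, and $\mathcal{A}^m$ the left $\mathcal{A}$-module of row vectors of length $m$. For any matrix $X$ over $\mathcal{A}$, the column space $R_X$ is the right submodule generated by its columns, and the row space $L_X$ is the left submodule generated by its rows; so $R_Q\le\mathcal{A}^k$ and $L_Q\le\mathcal{A}^m$.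 $Q$-dual: Let $R_Q\le M\le\mathcal{A}^k$. Choose a finitely generated free factor $M_{\mathrm{fin}}\le_* M$ containing $R_Q$ (one exists) and a basis $f_1,\dots,f_t$ of it; let $B\in\mathrm{Mat}_{t\times m}(\mathcal{A})$ be the unique matrix with $Q=(f_1\,|\,\cdots\,|\,f_t)B$. Then $M^{*Q}:=L_B\le\mathcal{A}^m$; it does not depend on the choices and contains $L_Q$. Symmetrically, let $L_Q\le M\le\mathcal{A}^m$. Choose a finitely generated free factor $M_{\mathrm{fin}}\le_* M$ containing $L_Q$ and a basis $g_1,\dots,g_t$ of it; let $C\in\mathrm{Mat}_{k\times t}(\mathcal{A})$ be the unique matrix with $Q=CG$, where $G$ is the matrix with rows $g_1,\dots,g_t$. Then $M^{*Q}:=R_C\le\mathcal{A}^k$; it does not depend on the choices and contains $R_Q$. *)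

theory Defs
  imports "Jordan_Normal_Form.Matrix" "HOL-Library.Equipollence"
begin

text \<open>
  The ring is the type \<open>'a :: ring_1\<close>, not assumed commutative. (The class requires
  \<open>0 \<noteq> 1\<close>; the zero ring is not a free ideal ring, because its modules have no well-defined
  rank.) Left and right modules are both given by records of type \<open>('a, 'b) module\<close>: in a left
  module \<open>a \<odot> v\<close> stands for \<open>a v\<close>, in a right module it stands for \<open>v a\<close>. Of the operations of
  the record only \<open>carrier\<close>, \<open>zero\<close>, \<open>add\<close> and \<open>smult\<close> matter; \<open>mult\<close> and \<open>one\<close> are ignored.
\<close>

definition left_regular :: "('a::ring_1, 'a) module" where
  "left_regular = \<lparr>carrier = UNIV, mult = undefined, one = undefined, zero = 0, add = (+),
     smult = (\<lambda>a x. a * x)\<rparr>"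

definition right_regular :: "('a::ring_1, 'a) module" where
  "right_regular = \<lparr>carrier = UNIV, mult = undefined, one = undefined, zero = 0, add = (+),
     smult = (\<lambda>a x. x * a)\<rparr>"

text \<open>The left module of row vectors and the right module of column vectors.\<close>

definition row_module :: "nat \<Rightarrow> ('a::ring_1, 'a vec) module" where
  "row_module m = module_vec TYPE('a) m"

definition col_module :: "nat \<Rightarrow> ('a::ring_1, 'a vec) module" where
  "col_module k = (module_vec TYPE('a) k)\<lparr>smult := (\<lambda>a v. map_vec (\<lambda>x. x * a) v)\<rparr>"

definition is_submodule :: "('a::ring_1, 'b) module \<Rightarrow> 'b set \<Rightarrow> bool" where
  "is_submodule V M \<longleftrightarrow>
     subgroup M (add_monoid V) \<and> (\<forall>a. \<forall>v\<in>M. a \<odot>\<^bsub>V\<^esub> v \<in> M)"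

definition lin_comb :: "('a::ring_1, 'b) module \<Rightarrow> ('b \<Rightarrow> 'a) \<Rightarrow> 'b set \<Rightarrow> 'b" where
  "lin_comb V c F = (\<Oplus>\<^bsub>V\<^esub>v\<in>F. c v \<odot>\<^bsub>V\<^esub> v)"

definition mod_span :: "('a::ring_1, 'b) module \<Rightarrow> 'b set \<Rightarrow> 'b set" where
  "mod_span V S = {lin_comb V c F | c F. finite F \<and> F \<subseteq> S}"

definition lin_indep :: "('a::ring_1, 'b) module \<Rightarrow> 'b set \<Rightarrow> bool" where
  "lin_indep V S \<longleftrightarrow>
     (\<forall>c F. finite F \<and> F \<subseteq> S \<and> lin_comb V c F = \<zero>\<^bsub>V\<^esub> \<longrightarrow> (\<forall>v\<in>F. c v = 0))"

text \<open>\<open>is_basis V M S\<close>: the submodule \<open>M\<close> of \<open>V\<close> is free with basis \<open>S\<close>.\<close>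

definition is_basis :: "('a::ring_1, 'b) module \<Rightarrow> 'b set \<Rightarrow> 'b set \<Rightarrow> bool" where
  "is_basis V M S \<longleftrightarrow> S \<subseteq> carrier V \<and> lin_indep V S \<and> mod_span V S = M"

definition is_free :: "('a::ring_1, 'b) module \<Rightarrow> 'b set \<Rightarrow> bool" where
  "is_free V M \<longleftrightarrow> (\<exists>S. is_basis V M S)"

definition has_unique_rank :: "('a::ring_1, 'b) module \<Rightarrow> 'b set \<Rightarrow> bool" where
  "has_unique_rank V M \<longleftrightarrow> (\<forall>S T. is_basis V M S \<and> is_basis V M T \<longrightarrow> S \<approx> T)"

definition free_ideal_ring :: "'a::ring_1 itself \<Rightarrow> bool" where
  "free_ideal_ring _ \<longleftrightarrow>
     (\<forall>I. is_submodule (left_regular :: ('a, 'a) module) I \<longrightarrow>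
        is_free (left_regular :: ('a, 'a) module) I \<and>
        has_unique_rank (left_regular :: ('a, 'a) module) I) \<and>
     (\<forall>I. is_submodule (right_regular :: ('a, 'a) module) I \<longrightarrow>
        is_free (right_regular :: ('a, 'a) module) I \<and>
        has_unique_rank (right_regular :: ('a, 'a) module) I)"

definition free_factor :: "('a::ring_1, 'b) module \<Rightarrow> 'b set \<Rightarrow> 'b set \<Rightarrow> bool" where
  "free_factor V M N \<longleftrightarrow> (\<exists>S T. is_basis V M S \<and> is_basis V N T \<and> S \<subseteq> T)"

definition algebraic_ext :: "('a::ring_1, 'b) module \<Rightarrow> 'b set \<Rightarrow> 'b set \<Rightarrow> bool" where
  "algebraic_ext V M N \<longleftrightarrow>
     is_submodule V M \<and> is_submodule V N \<and> M \<subseteq> N \<and>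
     \<not> (\<exists>L. free_factor V L N \<and> M \<subseteq> L \<and> L \<subset> N)"

definition algebraic_closure :: "('a::ring_1, 'b) module \<Rightarrow> 'b set \<Rightarrow> 'b set \<Rightarrow> 'b set" where
  "algebraic_closure V M N = (THE L. algebraic_ext V M L \<and> free_factor V L N)"

definition col_space :: "'a::ring_1 mat \<Rightarrow> 'a vec set" where
  "col_space X = mod_span (col_module (dim_row X)) (set (cols X))"

definition row_space :: "'a::ring_1 mat \<Rightarrow> 'a vec set" where
  "row_space X = mod_span (row_module (dim_col X)) (set (rows X))"

text \<open>
  \<open>is_dual_right Q M D\<close>: some choice of a finitely generated free factor of the right module
  \<open>M\<close>, of a basis \<open>fs\<close> of it and of the matrix \<open>B\<close> yields \<open>D\<close> as the \<open>Q\<close>-dual of \<open>M\<close>. The dual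
  itself is the \<open>D\<close> that all choices have in common, whence the definite description.
\<close>

definition is_dual_right :: "'a::ring_1 mat \<Rightarrow> 'a vec set \<Rightarrow> 'a vec set \<Rightarrow> bool" where
  "is_dual_right Q M D \<longleftrightarrow>
     (\<exists>Mfin fs B.
        free_factor (col_module (dim_row Q)) Mfin M \<and> col_space Q \<subseteq> Mfin \<and>
        distinct fs \<and> is_basis (col_module (dim_row Q)) Mfin (set fs) \<and>
        B \<in> carrier_mat (length fs) (dim_col Q) \<and>
        Q = mat_of_cols (dim_row Q) fs * B \<and>
        D = row_space B)"

definition dual_right :: "'a::ring_1 mat \<Rightarrow> 'a vec set \<Rightarrow> 'a vec set" where
  "dual_right Q M = (THE D. is_dual_right Q M D)"

text \<open>The \<open>Q\<close>-dual of a left module, symmetrically.\<close>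

definition is_dual_left :: "'a::ring_1 mat \<Rightarrow> 'a vec set \<Rightarrow> 'a vec set \<Rightarrow> bool" where
  "is_dual_left Q M D \<longleftrightarrow>
     (\<exists>Mfin gs C.
        free_factor (row_module (dim_col Q)) Mfin M \<and> row_space Q \<subseteq> Mfin \<and>
        distinct gs \<and> is_basis (row_module (dim_col Q)) Mfin (set gs) \<and>
        C \<in> carrier_mat (dim_row Q) (length gs) \<and>
        Q = C * mat_of_rows (dim_col Q) gs \<and>
        D = col_space C)"

definition dual_left :: "'a::ring_1 mat \<Rightarrow> 'a vec set \<Rightarrow> 'a vec set" where
  "dual_left Q M = (THE D. is_dual_left Q M D)"

end

theory Submission
  imports Defs
begin

text \<open>
  The \<open>Q\<close>-dual has a description that involves no choices. If \<open>Q = F B\<close>, where the columns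
  \<open>f\<^sub>1, \<dots>, f\<^sub>t\<close> of \<open>F\<close> are part of a basis of \<open>M\<close>, and if \<open>\<phi>\<close> is a linear functional on
  \<open>M\<close>, then the row of values of \<open>\<phi>\<close> at the columns of \<open>Q\<close> is \<open>(\<phi> f\<^sub>1, \<dots>, \<phi> f\<^sub>t) B\<close>. The values
  of a functional on part of a basis are arbitrary, so the row space of \<open>B\<close> consists exactly of
  these rows of values. Hence \<open>M\<^sup>*\<^sup>Q\<close> is the image of the dual module of \<open>M\<close> under evaluation
  at the columns of \<open>Q\<close>, which shows that it is well defined (\<open>evaluations_eq_coordinate_span\<close>,
  \<open>evaluations_free_factor\<close>, \<open>the_is_dual\<close>).

  The ring enters through one fact. Let \<open>\<phi>\<close> be a functional on a submodule \<open>M\<close> of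
  \<open>\<A>\<^sup>k\<close>. Its image is a one-sided ideal, hence free, so \<open>\<phi>\<close> splits and a basis of its kernel
  extends to a basis of \<open>M\<close> (\<open>kernel_basis_extends\<close>). Applied to the coordinates of \<open>\<A>\<^sup>k\<close> in
  turn, this gives that \<open>M\<close> is free (\<open>submodule_free\<close>), so that kernels of functionals are
  free factors. Therefore \<open>R \<le> L\<close> is algebraic if and only if every functional on \<open>L\<close> that
  vanishes on \<open>R\<close> is zero (\<open>algebraic_ext_iff\<close>). Uniqueness of the algebraic closure follows: if
  \<open>L\<close> is algebraic over \<open>R\<close> and \<open>K \<ge> R\<close> is a free factor of \<open>M \<ge> L\<close>, then the
  coordinates complementary to \<open>K\<close> vanish on \<open>R\<close>, hence on \<open>L\<close>, so \<open>L \<le> K\<close>.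

  For the double dual \<open>L\<close> of \<open>M\<close> (\<open>double_dual\<close>), let the rows of \<open>G\<close> be a basis of
  \<open>N = M\<^sup>*\<^sup>Q\<close> and write \<open>Q = C G\<close>; then \<open>L\<close> is the column space of \<open>C\<close>. Each row \<open>g\<close> of
  \<open>G\<close> is the row of values of a functional \<open>\<phi>\<^sub>g\<close> on \<open>M\<close>. Applying \<open>\<phi>\<^sub>h\<close> to \<open>Q = C G\<close> gives
  \<open>h = \<Sum>\<^sub>g \<phi>\<^sub>h(c\<^sub>g) g\<close>, and since the rows of \<open>G\<close> are independent, \<open>\<phi>\<^sub>h(c\<^sub>g)\<close> is \<open>1\<close> for
  \<open>g = h\<close> and \<open>0\<close> otherwise. So \<open>v \<mapsto> \<Sum>\<^sub>g c\<^sub>g \<phi>\<^sub>g(v)\<close> projects \<open>M\<close> onto \<open>L\<close>, the columns of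
  \<open>C\<close> are independent, and together with a basis of the kernel of the projection they form a basis
  of \<open>M\<close>: \<open>L\<close> is a free factor. It is algebraic over the column space of \<open>Q\<close>, because a
  functional \<open>\<psi>\<close> with \<open>\<psi>(Q) = \<psi>(C) G = 0\<close> satisfies \<open>\<psi>(C) = 0\<close> by independence of the rows of
  \<open>G\<close>.

  The two sides are treated at once: everything is proved for modules whose scalars act through an
  arbitrary ring multiplication \<open>mul\<close>, which is then taken to be the product or its opposite.
\<close>

section \<open>One-sided modules of vectors\<close>

text \<open>
  With \<open>mul = (*)\<close> this is the left module of row vectors, with \<open>mul = (\<lambda>a x. x * a)\<close> the right
  module of column vectors; exchanging the arguments of \<open>mul\<close> passes from one side to the other.
\<close>

definition vec_module :: "('a::ring_1 \<Rightarrow> 'a \<Rightarrow> 'a) \<Rightarrow> nat \<Rightarrow> ('a, 'a vec) module" where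
  "vec_module mul n = (module_vec TYPE('a) n)\<lparr>smult := (\<lambda>a v. map_vec (mul a) v)\<rparr>"

definition regular_module :: "('a::ring_1 \<Rightarrow> 'a \<Rightarrow> 'a) \<Rightarrow> ('a, 'a) module" where
  "regular_module mul = \<lparr>carrier = UNIV, mult = undefined, one = undefined, zero = 0, add = (+),
     smult = mul\<rparr>"

text \<open>
  A combination of an indexed family rather than of a set of vectors, since coordinate vectors such as
  the rows of \<open>B\<close> in \<open>Q = F B\<close> may coincide.
\<close>

definition comb :: "('a::ring_1 \<Rightarrow> 'a \<Rightarrow> 'a) \<Rightarrow> nat \<Rightarrow> ('b \<Rightarrow> 'a) \<Rightarrow> ('b \<Rightarrow> 'a vec) \<Rightarrow> 'b set \<Rightarrow> 'a vec"
  where "comb mul n a w I = vec n (\<lambda>i. \<Sum>x\<in>I. mul (a x) (w x $ i))"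

text \<open>
  The dual module of \<open>M\<close>, represented by functions of which only the values on \<open>M\<close> matter.
\<close>

definition functional :: "('a::ring_1 \<Rightarrow> 'a \<Rightarrow> 'a) \<Rightarrow> 'a vec set \<Rightarrow> ('a vec \<Rightarrow> 'a) \<Rightarrow> bool" where
  "functional mul M \<phi> \<longleftrightarrow>
     (\<forall>u\<in>M. \<forall>v\<in>M. \<phi> (u + v) = \<phi> u + \<phi> v) \<and> (\<forall>a. \<forall>v\<in>M. \<phi> (map_vec (mul a) v) = mul a (\<phi> v))"

text \<open>
  The image of the dual module of \<open>M\<close> under evaluation at \<open>q 0, \<dots>, q (m - 1)\<close>.
\<close>

definition evaluations ::
  "('a::ring_1 \<Rightarrow> 'a \<Rightarrow> 'a) \<Rightarrow> 'a vec set \<Rightarrow> nat \<Rightarrow> (nat \<Rightarrow> 'a vec) \<Rightarrow> 'a vec set" where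
  "evaluations mul M m q = {vec m (\<lambda>j. \<phi> (q j)) | \<phi>. functional mul M \<phi>}"

lemma vec_module_simps [simp]:
  "carrier (vec_module mul n) = carrier_vec n"
  "zero (vec_module mul n) = 0\<^sub>v n"
  "add (vec_module mul n) = (+)"
  "smult (vec_module mul n) a v = map_vec (mul a) v"
  by (simp_all add: vec_module_def module_vec_simps)

lemma comb_carrier [simp]: "comb mul n a w I \<in> carrier_vec n"
  by (simp add: comb_def)

lemma dim_comb [simp]: "dim_vec (comb mul n a w I) = n"
  by (simp add: comb_def)

lemma index_comb [simp]: "i < n \<Longrightarrow> comb mul n a w I $ i = (\<Sum>x\<in>I. mul (a x) (w x $ i))"
  by (simp add: comb_def)

lemma comb_cong:
  assumes "\<And>x. x \<in> I \<Longrightarrow> a x = b x" and "\<And>x. x \<in> I \<Longrightarrow> w x = u x"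
  shows "comb mul n a w I = comb mul n b u I"
  unfolding comb_def using assms by simp

lemma comb_Un_disjoint:
  assumes "finite I" "finite J" "I \<inter> J = {}"
  shows "comb mul n a w (I \<union> J) = comb mul n a w I + comb mul n a w J"
  using assms by (intro eq_vecI) (auto simp: sum.union_disjoint comb_def)

lemma comb_empty: "comb mul n a w {} = 0\<^sub>v n"
  by (auto simp: comb_def)

lemma comb_insert:
  assumes "finite I" "x \<notin> I" "w x \<in> carrier_vec n"
  shows "comb mul n a w (insert x I) = map_vec (mul (a x)) (w x) + comb mul n a w I"
  using assms by (intro eq_vecI) (auto simp: comb_def)

lemma comb_image:
  assumes "inj_on w I"
  shows "comb mul n c (\<lambda>v. v) (w ` I) = comb mul n (\<lambda>x. c (w x)) w I"
  unfolding comb_def by (simp add: sum.reindex[OF assms])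

text \<open>
  The product of \<open>'a\<close> and the opposite product both satisfy these axioms, so a statement proved here
  holds for left and for right modules, and both versions can be used side by side.
\<close>

locale ring_mult =
  fixes mul :: "'a::ring_1 \<Rightarrow> 'a \<Rightarrow> 'a"
  assumes mul_assoc: "mul (mul a b) c = mul a (mul b c)"
    and mul_add_left: "mul (a + b) c = mul a c + mul b c"
    and mul_add_right: "mul a (b + c) = mul a b + mul a c"
    and mul_one_left [simp]: "mul 1 a = a"
    and mul_one_right [simp]: "mul a 1 = a"
begin

lemma opposite: "ring_mult (\<lambda>a b. mul b a)"
  by unfold_locales (simp_all add: mul_assoc mul_add_left mul_add_right)

lemma mul_zero_left [simp]: "mul 0 a = 0"
  using mul_add_left[of 0 0 a] by simp

lemma mul_zero_right [simp]: "mul a 0 = 0"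
  using mul_add_right[of a 0 0] by simp

lemma mul_minus_left: "mul (- a) b = - mul a b"
  using mul_add_left[of "- a" a b] by (simp add: eq_neg_iff_add_eq_0)

lemma mul_diff_left: "mul (a - b) c = mul a c - mul b c"
  using mul_add_left[of a "- b" c] by (simp add: mul_minus_left)

lemma mul_sum_right: "mul a (\<Sum>x\<in>I. f x) = (\<Sum>x\<in>I. mul a (f x))"
  by (induction I rule: infinite_finite_induct) (simp_all add: mul_add_right)

abbreviation V :: "nat \<Rightarrow> ('a, 'a vec) module" where
  "V n \<equiv> vec_module mul n"

lemma comb_mono_neutral:
  assumes "finite J" "I \<subseteq> J" "\<And>x. x \<in> J - I \<Longrightarrow> a x = 0"
  shows "comb mul n a w J = comb mul n a w I"
  using assms by (intro eq_vecI) (auto intro!: sum.mono_neutral_right)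

lemma comb_add: "comb mul n (\<lambda>x. a x + b x) w I = comb mul n a w I + comb mul n b w I"
  by (intro eq_vecI) (auto simp: comb_def mul_add_left sum.distrib)

lemma comb_diff: "comb mul n (\<lambda>x. a x - b x) w I = comb mul n a w I - comb mul n b w I"
  by (intro eq_vecI) (auto simp: comb_def mul_diff_left sum_subtractf)

lemma comb_scale: "comb mul n (\<lambda>x. mul r (a x)) w I = map_vec (mul r) (comb mul n a w I)"
  by (intro eq_vecI) (auto simp: comb_def mul_assoc mul_sum_right)

lemma comb_delta:
  assumes "finite I" "x \<in> I" "w x \<in> carrier_vec n"
  shows "comb mul n (\<lambda>y. if y = x then 1 else 0) w I = w x"
proof -
  have "mul (if y = x then 1 else 0) z = (if y = x then z else 0)" for y z by simp
  then show ?thesis using assms by (intro eq_vecI) (auto simp: comb_def)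
qed

lemma is_submodule_iff:
  "is_submodule (V n) M \<longleftrightarrow> M \<subseteq> carrier_vec n \<and> 0\<^sub>v n \<in> M \<and>
     (\<forall>u\<in>M. \<forall>v\<in>M. u + v \<in> M) \<and> (\<forall>a. \<forall>v\<in>M. map_vec (mul a) v \<in> M)"
  (is "_ \<longleftrightarrow> ?R")
proof
  assume "is_submodule (V n) M"
  then have s: "subgroup M (add_monoid (V n))" and c: "\<forall>a. \<forall>v\<in>M. map_vec (mul a) v \<in> M"
    by (simp_all add: is_submodule_def)
  show ?R
    using subgroup.subset[OF s] subgroup.one_closed[OF s] subgroup.m_closed[OF s] c by auto
next
  assume R: ?R
  have grp: "comm_group (add_monoid (V n))"
  proof unfold_locales
    show "carrier (add_monoid (V n)) \<subseteq> Units (add_monoid (V n))"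
    proof
      fix v assume "v \<in> carrier (add_monoid (V n))"
      then have v: "v \<in> carrier_vec n" by simp
      then show "v \<in> Units (add_monoid (V n))"
        unfolding Units_def using uminus_l_inv_vec[OF v] uminus_r_inv_vec[OF v]
        by (auto intro!: bexI[of _ "- v"])
    qed
  qed (auto simp: ac_simps)
  then interpret G: comm_group "add_monoid (V n)" .
  have "subgroup M (add_monoid (V n))"
  proof (rule G.subgroupI)
    fix v assume v: "v \<in> M"
    then have vc: "v \<in> carrier_vec n" using R by auto
    have "map_vec (mul (- 1)) v = - v" using vc by (auto simp: mul_minus_left)
    moreover have "inv\<^bsub>add_monoid (V n)\<^esub> v = - v"
      by (rule G.inv_equality) (use vc in \<open>auto intro: uminus_l_inv_vec\<close>)
    ultimately show "inv\<^bsub>add_monoid (V n)\<^esub> v \<in> M" using R v by metis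
  qed (use R in auto)
  then show "is_submodule (V n) M" using R by (simp add: is_submodule_def)
qed

lemma lin_comb_vec:
  assumes "finite F" "F \<subseteq> carrier_vec n"
  shows "lin_comb (V n) c F = comb mul n c (\<lambda>v. v) F"
proof -
  interpret abelian_monoid "V n" by unfold_locales (auto simp: ac_simps)
  have "(\<Oplus>\<^bsub>V n\<^esub>v\<in>F. c v \<odot>\<^bsub>V n\<^esub> v) = comb mul n c (\<lambda>v. v) F"
    using assms
  proof (induction F rule: finite_induct)
    case empty then show ?case using comb_empty[of mul n c "\<lambda>v. v"] by simp
  next
    case (insert x F)
    then show ?case by (subst finsum_insert) (auto simp: comb_insert)
  qed
  then show ?thesis by (simp add: lin_comb_def)
qed

lemma lin_comb_regular:
  assumes "finite F"
  shows "lin_comb (regular_module mul) c F = (\<Sum>v\<in>F. mul (c v) v)"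
proof -
  interpret abelian_monoid "regular_module mul" by unfold_locales (auto simp: regular_module_def ac_simps)
  have "(\<Oplus>\<^bsub>regular_module mul\<^esub>v\<in>F. c v \<odot>\<^bsub>regular_module mul\<^esub> v) = (\<Sum>v\<in>F. mul (c v) v)"
    using assms
  proof (induction F rule: finite_induct)
    case empty then show ?case by simp (simp add: regular_module_def)
  next
    case (insert x F)
    then show ?case by (subst finsum_insert) (auto simp: regular_module_def)
  qed
  then show ?thesis by (simp add: lin_comb_def)
qed

lemma mod_span_vec:
  assumes "S \<subseteq> carrier_vec n"
  shows "mod_span (V n) S = {comb mul n c (\<lambda>v. v) F | c F. finite F \<and> F \<subseteq> S}"
proof -
  have "lin_comb (V n) c F = comb mul n c (\<lambda>v. v) F" if "finite F" "F \<subseteq> S" for c F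
    using that assms by (intro lin_comb_vec) auto
  then show ?thesis unfolding mod_span_def by (auto 0 3) metis+
qed

lemma lin_indep_vec:
  assumes "S \<subseteq> carrier_vec n"
  shows "lin_indep (V n) S \<longleftrightarrow>
     (\<forall>c F. finite F \<and> F \<subseteq> S \<and> comb mul n c (\<lambda>v. v) F = 0\<^sub>v n \<longrightarrow> (\<forall>v\<in>F. c v = 0))"
proof -
  have "lin_comb (V n) c F = comb mul n c (\<lambda>v. v) F" if "finite F" "F \<subseteq> S" for c F
    using that assms by (intro lin_comb_vec) auto
  then show ?thesis unfolding lin_indep_def vec_module_simps(2) by (simp cong: conj_cong)
qed

lemma submodule_comb:
  assumes M: "is_submodule (V n) M" and w: "\<And>x. x \<in> I \<Longrightarrow> w x \<in> M" and fin: "finite I"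
  shows "comb mul n a w I \<in> M"
  using fin w
proof (induction I rule: finite_induct)
  case empty then show ?case using M by (simp add: comb_empty is_submodule_iff)
next
  case (insert x I)
  have "w x \<in> carrier_vec n" using M insert.prems by (auto simp: is_submodule_iff)
  then show ?case using insert M by (simp add: comb_insert is_submodule_iff)
qed

lemma mod_span_minimal:
  assumes "is_submodule (V n) M" "S \<subseteq> M"
  shows "mod_span (V n) S \<subseteq> M"
proof -
  have "S \<subseteq> carrier_vec n" using assms by (auto simp: is_submodule_iff)
  then show ?thesis
    unfolding mod_span_vec[OF \<open>S \<subseteq> carrier_vec n\<close>] using assms(2)
    by (auto intro!: submodule_comb[OF assms(1)])
qed

lemma mod_span_superset:
  assumes "S \<subseteq> carrier_vec n"
  shows "S \<subseteq> mod_span (V n) S"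
proof
  fix v assume v: "v \<in> S"
  have "comb mul n (\<lambda>x. if x = v then 1 else 0) (\<lambda>v. v) {v} = v"
    by (rule comb_delta) (use v assms in auto)
  then show "v \<in> mod_span (V n) S"
    unfolding mod_span_vec[OF assms] using v by (auto intro!: exI[of _ "{v}"] exI[of _ "\<lambda>x. if x = v then 1 else 0"])
qed

lemma is_submodule_mod_span:
  assumes S: "S \<subseteq> carrier_vec n"
  shows "is_submodule (V n) (mod_span (V n) S)"
proof -
  let ?c = "\<lambda>c F. comb mul n c (\<lambda>v. v) F"
  have "u + v \<in> mod_span (V n) S" if "u \<in> mod_span (V n) S" "v \<in> mod_span (V n) S" for u v
  proof -
    from that obtain c F d G where u: "u = ?c c F" "finite F" "F \<subseteq> S"
      and v: "v = ?c d G" "finite G" "G \<subseteq> S"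
      unfolding mod_span_vec[OF S] by blast
    have "u = ?c (\<lambda>x. if x \<in> F then c x else 0) (F \<union> G)"
      unfolding u by (subst comb_mono_neutral[of "F \<union> G" F]) (use u v in \<open>auto intro: comb_cong\<close>)
    moreover have "v = ?c (\<lambda>x. if x \<in> G then d x else 0) (F \<union> G)"
      unfolding v by (subst comb_mono_neutral[of "F \<union> G" G]) (use u v in \<open>auto intro: comb_cong\<close>)
    ultimately have "u + v = ?c (\<lambda>x. (if x \<in> F then c x else 0) + (if x \<in> G then d x else 0)) (F \<union> G)"
      by (simp only: comb_add)
    then show ?thesis unfolding mod_span_vec[OF S] using u v by blast
  qed
  moreover have "0\<^sub>v n \<in> mod_span (V n) S"
    unfolding mod_span_vec[OF S] by (auto intro!: exI[of _ "{}"] simp: comb_empty)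
  moreover have "map_vec (mul a) v \<in> mod_span (V n) S" if "v \<in> mod_span (V n) S" for a v
    using that unfolding mod_span_vec[OF S] by (auto simp flip: comb_scale) blast
  moreover have "mod_span (V n) S \<subseteq> carrier_vec n" unfolding mod_span_vec[OF S] by auto
  ultimately show ?thesis by (simp add: is_submodule_iff)
qed

lemma mod_span_mono:
  assumes "S \<subseteq> T" "T \<subseteq> carrier_vec n"
  shows "mod_span (V n) S \<subseteq> mod_span (V n) T"
  using assms mod_span_superset[of T n] by (intro mod_span_minimal is_submodule_mod_span) auto

lemma is_basis_submodule: "is_basis (V n) M S \<Longrightarrow> is_submodule (V n) M"
  using is_submodule_mod_span by (auto simp: is_basis_def)

lemma free_factor_subset:
  assumes "free_factor (V n) K M"
  shows "K \<subseteq> M"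
proof -
  obtain S T where "is_basis (V n) K S" "is_basis (V n) M T" "S \<subseteq> T"
    using assms by (auto simp: free_factor_def)
  then show ?thesis using mod_span_mono[of S T n] by (auto simp: is_basis_def)
qed

lemma is_basis_subset: "is_basis (V n) M S \<Longrightarrow> S \<subseteq> M"
  using mod_span_superset by (auto simp: is_basis_def)

section \<open>Bases and linear functionals\<close>

lemma basis_comb:
  assumes "is_basis (V n) M T" "v \<in> M"
  obtains c F where "finite F" "F \<subseteq> T" "v = comb mul n c (\<lambda>v. v) F" "\<And>t. t \<notin> F \<Longrightarrow> c t = 0"
proof -
  have "v \<in> mod_span (V n) T" "T \<subseteq> carrier_vec n" using assms by (auto simp: is_basis_def)
  then obtain c F where F: "finite F" "F \<subseteq> T" "v = comb mul n c (\<lambda>v. v) F"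
    by (auto simp: mod_span_vec)
  moreover have "v = comb mul n (\<lambda>t. if t \<in> F then c t else 0) (\<lambda>v. v) F"
    unfolding F(3) by (rule comb_cong) auto
  ultimately show thesis using that[of F "\<lambda>t. if t \<in> F then c t else 0"] by auto
qed

lemma basis_indep:
  assumes "is_basis (V n) M T" "finite F" "F \<subseteq> T" "comb mul n c (\<lambda>v. v) F = 0\<^sub>v n" "v \<in> F"
  shows "c v = 0"
  using assms lin_indep_vec[of T n] unfolding is_basis_def by auto

lemma basis_coeffs_unique:
  assumes T: "is_basis (V n) M T" and F: "finite F" "F \<subseteq> T" and G: "finite G" "G \<subseteq> T"
    and eq: "comb mul n c (\<lambda>v. v) F = comb mul n d (\<lambda>v. v) G"
    and c: "\<And>t. t \<notin> F \<Longrightarrow> c t = 0" and d: "\<And>t. t \<notin> G \<Longrightarrow> d t = 0"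
  shows "c = d"
proof
  fix t
  have "comb mul n c (\<lambda>v. v) (F \<union> G) = comb mul n c (\<lambda>v. v) F"
    by (rule comb_mono_neutral) (use F G c in auto)
  moreover have "comb mul n d (\<lambda>v. v) (F \<union> G) = comb mul n d (\<lambda>v. v) G"
    by (rule comb_mono_neutral) (use F G d in auto)
  ultimately have "comb mul n (\<lambda>t. c t - d t) (\<lambda>v. v) (F \<union> G) = 0\<^sub>v n"
    using eq by (simp add: comb_diff)
  then have "t \<in> F \<union> G \<Longrightarrow> c t - d t = 0"
    using basis_indep[OF T, of "F \<union> G" "\<lambda>t. c t - d t" t] F G by simp
  then show "c t = d t" using c[of t] d[of t] by (cases "t \<in> F \<union> G") auto
qed

text \<open>
  The universal property of a basis, for maps to the ring: the functional sends a vector to the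
  combination of the prescribed values with its coordinates as coefficients, and uniqueness of
  coordinates makes this linear.
\<close>

lemma basis_functional:
  assumes T: "is_basis (V n) M T"
  obtains \<phi> where "functional mul M \<phi>" "\<And>t. t \<in> T \<Longrightarrow> \<phi> t = \<alpha> t"
proof -
  have "\<exists>c F. finite F \<and> F \<subseteq> T \<and> v = comb mul n c (\<lambda>v. v) F \<and> (\<forall>t. t \<notin> F \<longrightarrow> c t = 0)"
    if "v \<in> M" for v
    using basis_comb[OF T that] by metis
  \<comment> \<open>\<open>K v\<close> holds the coordinates of \<open>v\<close>, extended by zero outside the finite set \<open>F v\<close>.\<close>
  then obtain K F where KF: "\<And>v. v \<in> M \<Longrightarrow> finite (F v) \<and> F v \<subseteq> T \<and>
      v = comb mul n (K v) (\<lambda>v. v) (F v) \<and> (\<forall>t. t \<notin> F v \<longrightarrow> K v t = 0)"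
    by metis
  have M: "is_submodule (V n) M" by (rule is_basis_submodule[OF T])
  have K_eq: "K v = c" if "v \<in> M" "finite G" "G \<subseteq> T" "v = comb mul n c (\<lambda>v. v) G"
    "\<And>t. t \<notin> G \<Longrightarrow> c t = 0" for v c G
    by (rule basis_coeffs_unique[OF T, of "F v" G]) (use that KF[OF that(1)] in metis)+
  define \<phi> where "\<phi> v = (\<Sum>t | K v t \<noteq> 0. mul (K v t) (\<alpha> t))" for v
  have \<phi>_eq: "\<phi> v = (\<Sum>t\<in>G. mul (K v t) (\<alpha> t))" if "v \<in> M" "finite G" "F v \<subseteq> G" for v G
    unfolding \<phi>_def by (rule sum.mono_neutral_left) (use that KF[OF that(1)] in auto)
  have wide: "v = comb mul n (K v) (\<lambda>v. v) G" if "v \<in> M" "finite G" "F v \<subseteq> G" for v G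
    using KF[OF that(1)] comb_mono_neutral[OF that(2,3), of "K v" n "\<lambda>v. v"] by auto
  have "functional mul M \<phi>"
    unfolding functional_def
  proof (intro conjI ballI allI)
    fix u v assume uv: "u \<in> M" "v \<in> M"
    define G where "G = F u \<union> F v \<union> F (u + v)"
    have s: "u + v \<in> M" using uv M by (simp add: is_submodule_iff)
    have G: "finite G" "G \<subseteq> T" "F u \<subseteq> G" "F v \<subseteq> G" "F (u + v) \<subseteq> G"
      using KF[OF uv(1)] KF[OF uv(2)] KF[OF s] by (auto simp: G_def)
    have "K (u + v) = (\<lambda>t. K u t + K v t)"
    proof (rule K_eq[OF s G(1,2)])
      show "u + v = comb mul n (\<lambda>t. K u t + K v t) (\<lambda>v. v) G"
        unfolding comb_add using wide[OF uv(1) G(1,3)] wide[OF uv(2) G(1,4)] by simp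
    qed (use KF[OF uv(1)] KF[OF uv(2)] in \<open>auto simp: G_def\<close>)
    then show "\<phi> (u + v) = \<phi> u + \<phi> v"
      using \<phi>_eq[OF uv(1) G(1,3)] \<phi>_eq[OF uv(2) G(1,4)] \<phi>_eq[OF s G(1,5)]
      by (simp add: mul_add_left sum.distrib)
  next
    fix a v assume v: "v \<in> M"
    define G where "G = F v \<union> F (map_vec (mul a) v)"
    have s: "map_vec (mul a) v \<in> M" using v M by (simp add: is_submodule_iff)
    have G: "finite G" "G \<subseteq> T" "F v \<subseteq> G" "F (map_vec (mul a) v) \<subseteq> G"
      using KF[OF v] KF[OF s] by (auto simp: G_def)
    have "K (map_vec (mul a) v) = (\<lambda>t. mul a (K v t))"
    proof (rule K_eq[OF s G(1,2)])
      show "map_vec (mul a) v = comb mul n (\<lambda>t. mul a (K v t)) (\<lambda>v. v) G"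
        unfolding comb_scale using wide[OF v G(1,3)] by simp
    qed (use KF[OF v] in \<open>auto simp: G_def\<close>)
    then show "\<phi> (map_vec (mul a) v) = mul a (\<phi> v)"
      using \<phi>_eq[OF v G(1,3)] \<phi>_eq[OF s G(1,4)] by (simp add: mul_assoc mul_sum_right)
  qed
  moreover have "\<phi> t = \<alpha> t" if t: "t \<in> T" for t
  proof -
    have tM: "t \<in> M" "t \<in> carrier_vec n" using is_basis_subset[OF T] t M by (auto simp: is_submodule_iff)
    have K: "K t = (\<lambda>s. if s = t then 1 else 0)"
      by (rule K_eq[OF tM(1), of "{t}"]) (use t tM comb_delta[of "{t}" t "\<lambda>v. v" n] in auto)
    have "{s. K t s \<noteq> 0} = {t}" unfolding K by auto
    then show ?thesis by (simp add: \<phi>_def K)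
  qed
  ultimately show thesis using that by blast
qed

lemma functional_zero:
  assumes "is_submodule (V n) M" "functional mul M \<phi>"
  shows "\<phi> (0\<^sub>v n) = 0"
  using assms by (auto simp: is_submodule_iff functional_def dest!: bspec[of M _ "0\<^sub>v n"])

lemma functional_comb:
  assumes M: "is_submodule (V n) M" and \<phi>: "functional mul M \<phi>"
    and fin: "finite I" and w: "\<And>x. x \<in> I \<Longrightarrow> w x \<in> M"
  shows "\<phi> (comb mul n a w I) = (\<Sum>x\<in>I. mul (a x) (\<phi> (w x)))"
  using fin w
proof (induction I rule: finite_induct)
  case empty then show ?case using functional_zero[OF M \<phi>] by (simp add: comb_empty)
next
  case (insert x I)
  have x: "w x \<in> M" "w x \<in> carrier_vec n" using M insert.prems by (auto simp: is_submodule_iff)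
  have "map_vec (mul (a x)) (w x) \<in> M" using M x by (simp add: is_submodule_iff)
  moreover have "comb mul n a w I \<in> M" using insert by (intro submodule_comb[OF M]) auto
  ultimately show ?case using insert x \<phi> by (simp add: comb_insert functional_def)
qed

lemma functional_mono: "functional mul M \<phi> \<Longrightarrow> L \<subseteq> M \<Longrightarrow> functional mul L \<phi>"
  unfolding functional_def by blast

lemma functional_index:
  assumes "is_submodule (V n) M" "i < n"
  shows "functional mul M (\<lambda>v. v $ i)"
proof -
  have "dim_vec v = n" if "v \<in> M" for v using assms that by (auto simp: is_submodule_iff)
  then show ?thesis using assms by (auto simp: functional_def)
qed

lemma functional_eq_on_basis:
  assumes S: "is_basis (V n) M S" and "functional mul M \<phi>" "functional mul M \<psi>"
    and eq: "\<And>s. s \<in> S \<Longrightarrow> \<phi> s = \<psi> s" and v: "v \<in> M"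
  shows "\<phi> v = \<psi> v"
proof -
  obtain c F where F: "finite F" "F \<subseteq> S" "v = comb mul n c (\<lambda>v. v) F"
    using basis_comb[OF S v] by metis
  have FM: "\<And>x. x \<in> F \<Longrightarrow> x \<in> M" using F is_basis_subset[OF S] by auto
  have "\<phi> v = (\<Sum>x\<in>F. mul (c x) (\<phi> x))" "\<psi> v = (\<Sum>x\<in>F. mul (c x) (\<psi> x))"
    unfolding F(3)
    by (rule functional_comb[OF is_basis_submodule[OF S]]; use assms F FM in simp)+
  then show ?thesis using eq F(2) by (auto intro!: sum.cong)
qed

lemma functional_zero_on_basis:
  assumes "is_basis (V n) M S" "functional mul M \<phi>" "\<And>s. s \<in> S \<Longrightarrow> \<phi> s = 0" "v \<in> M"
  shows "\<phi> v = 0"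
  by (rule functional_eq_on_basis[where \<psi> = "\<lambda>_. 0"]) (use assms in \<open>auto simp: functional_def\<close>)

lemma kernel_submodule:
  assumes M: "is_submodule (V n) M" and \<phi>: "functional mul M \<phi>"
  shows "is_submodule (V n) {v \<in> M. \<phi> v = 0}"
  using M \<phi> functional_zero[OF M \<phi>] unfolding is_submodule_iff functional_def by auto

text \<open>
  A basis of a submodule \<open>K\<close> together with representatives of a basis of \<open>M / K\<close> is a basis of \<open>M\<close>;
  \<open>indep\<close> and \<open>gen\<close> say that \<open>U\<close> represents such a basis.
\<close>

lemma is_basis_union:
  assumes M: "is_submodule (V n) M" and S: "is_basis (V n) K S" and KM: "K \<subseteq> M" and U: "U \<subseteq> M"
    and indep: "\<And>c F v. finite F \<Longrightarrow> F \<subseteq> U \<Longrightarrow> comb mul n c (\<lambda>v. v) F \<in> K \<Longrightarrow> v \<in> F \<Longrightarrow> c v = 0"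
    and gen: "\<And>v. v \<in> M \<Longrightarrow> \<exists>u\<in>K. \<exists>w\<in>mod_span (V n) U. v = u + w"
  shows "is_basis (V n) M (S \<union> U)"
proof -
  have K: "is_submodule (V n) K" by (rule is_basis_submodule[OF S])
  have carrier: "S \<union> U \<subseteq> carrier_vec n"
    using M KM U is_basis_subset[OF S] by (auto simp: is_submodule_iff)
  have "c v = 0" if F: "finite F" "F \<subseteq> S \<union> U" and zero: "comb mul n c (\<lambda>v. v) F = 0\<^sub>v n"
    and v: "v \<in> F" for c F v
  proof -
    let ?s = "comb mul n c (\<lambda>v. v) (F - U)" and ?u = "comb mul n c (\<lambda>v. v) (F \<inter> U)"
    have "?s + ?u = 0\<^sub>v n"
    proof -
      have "F - U \<union> F \<inter> U = F" "(F - U) \<inter> (F \<inter> U) = {}" by auto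
      then show ?thesis
        using comb_Un_disjoint[of "F - U" "F \<inter> U" mul n c "\<lambda>v. v"] F zero by simp
    qed
    moreover have "?s \<in> K"
      by (rule submodule_comb[OF K]) (use F is_basis_subset[OF S] in auto)
    moreover have "?u = - ?s" if "?s + ?u = 0\<^sub>v n"
      using that by (auto simp: vec_eq_iff eq_neg_iff_add_eq_0 add.commute)
    moreover have "map_vec (mul (- 1)) ?s = - ?s" by (auto simp: mul_minus_left)
    ultimately have "?u \<in> K" using K by (metis is_submodule_iff)
    then have cU: "c w = 0" if "w \<in> F \<inter> U" for w
      using indep[of "F \<inter> U" c w] F that by auto
    have "comb mul n c (\<lambda>v. v) (F - U) = 0\<^sub>v n"
      using zero comb_mono_neutral[of F "F - U" c n "\<lambda>v. v"] F cU by auto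
    then have "c w = 0" if "w \<in> F - U" for w
      using basis_indep[OF S, of "F - U" c w] F that by auto
    then show ?thesis using cU v by auto
  qed
  then have "lin_indep (V n) (S \<union> U)" unfolding lin_indep_vec[OF carrier] by blast
  moreover have "mod_span (V n) (S \<union> U) = M"
  proof
    show "mod_span (V n) (S \<union> U) \<subseteq> M"
      using is_basis_subset[OF S] KM U by (intro mod_span_minimal[OF M]) auto
    show "M \<subseteq> mod_span (V n) (S \<union> U)"
    proof
      fix v assume "v \<in> M"
      then obtain u w where v: "v = u + w" "u \<in> K" "w \<in> mod_span (V n) U" using gen by blast
      have "K = mod_span (V n) S" using S by (simp add: is_basis_def)
      then have "u \<in> mod_span (V n) (S \<union> U)" "w \<in> mod_span (V n) (S \<union> U)"
        using v mod_span_mono[of S "S \<union> U" n] mod_span_mono[of U "S \<union> U" n] carrier by auto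
      then show "v \<in> mod_span (V n) (S \<union> U)"
        using is_submodule_mod_span[OF carrier] v(1) by (simp add: is_submodule_iff)
    qed
  qed
  ultimately show ?thesis using carrier by (simp add: is_basis_def)
qed

lemma image_ideal:
  assumes M: "is_submodule (V n) M" and \<phi>: "functional mul M \<phi>"
  shows "is_submodule (regular_module mul) (\<phi> ` M)"
proof -
  have grp: "comm_group (add_monoid (regular_module mul))"
  proof unfold_locales
    show "carrier (add_monoid (regular_module mul)) \<subseteq> Units (add_monoid (regular_module mul))"
      by (auto simp: Units_def regular_module_def intro: exI[of _ "- _"])
  qed (auto simp: regular_module_def ac_simps)
  then interpret G: comm_group "add_monoid (regular_module mul)" .
  have smult: "mul a x \<in> \<phi> ` M" if "x \<in> \<phi> ` M" for a x
  proof -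
    from that obtain v where v: "v \<in> M" "x = \<phi> v" by blast
    then have "mul a x = \<phi> (map_vec (mul a) v)" "map_vec (mul a) v \<in> M"
      using M \<phi> by (auto simp: functional_def is_submodule_iff)
    then show ?thesis by blast
  qed
  have "subgroup (\<phi> ` M) (add_monoid (regular_module mul))"
  proof (rule G.subgroupI)
    fix x assume x: "x \<in> \<phi> ` M"
    have "inv\<^bsub>add_monoid (regular_module mul)\<^esub> x = - x"
      by (rule G.inv_equality) (auto simp: regular_module_def)
    then show "inv\<^bsub>add_monoid (regular_module mul)\<^esub> x \<in> \<phi> ` M"
      using smult[OF x, of "- 1"] by (simp add: mul_minus_left)
  next
    fix x y assume "x \<in> \<phi> ` M" "y \<in> \<phi> ` M"
    then obtain u v where "u \<in> M" "v \<in> M" "x = \<phi> u" "y = \<phi> v" by blast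
    then have "x + y = \<phi> (u + v)" "u + v \<in> M"
      using M \<phi> by (auto simp: functional_def is_submodule_iff)
    then show "x \<otimes>\<^bsub>add_monoid (regular_module mul)\<^esub> y \<in> \<phi> ` M" by (simp add: regular_module_def)
  qed (use M in \<open>auto simp: regular_module_def is_submodule_iff\<close>)
  then show ?thesis using smult by (simp add: is_submodule_def regular_module_def)
qed

lemma is_basis_of_subset:
  assumes "is_basis (V n) M T" "S \<subseteq> T"
  shows "is_basis (V n) (mod_span (V n) S) S"
  using assms unfolding is_basis_def lin_indep_def by (meson order_trans)

text \<open>
  Finitely many vectors involve only finitely many elements of a basis. This yields the finitely
  generated free factor on which the dual is computed.
\<close>

lemma basis_finite_support:
  assumes T: "is_basis (V n) M T" and X: "finite X" "X \<subseteq> M"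
  obtains F where "finite F" "F \<subseteq> T"
    "\<And>x. x \<in> X \<Longrightarrow> \<exists>c. (\<forall>t. t \<notin> F \<longrightarrow> c t = 0) \<and> x = comb mul n c (\<lambda>v. v) F"
proof -
  have "\<exists>c F. finite F \<and> F \<subseteq> T \<and> (\<forall>t. t \<notin> F \<longrightarrow> c t = 0) \<and> x = comb mul n c (\<lambda>v. v) F"
    if "x \<in> X" for x
    using basis_comb[OF T, of x] that X(2) by (metis subsetD)
  then obtain c F where cF: "\<And>x. x \<in> X \<Longrightarrow> finite (F x) \<and> F x \<subseteq> T \<and>
      (\<forall>t. t \<notin> F x \<longrightarrow> c x t = 0) \<and> x = comb mul n (c x) (\<lambda>v. v) (F x)"
    by metis
  let ?F = "\<Union>x\<in>X. F x"
  have "\<exists>d. (\<forall>t. t \<notin> ?F \<longrightarrow> d t = 0) \<and> x = comb mul n d (\<lambda>v. v) ?F" if x: "x \<in> X" for x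
  proof (intro exI conjI)
    have "comb mul n (c x) (\<lambda>v. v) ?F = comb mul n (c x) (\<lambda>v. v) (F x)"
      by (rule comb_mono_neutral) (use cF X x in auto)
    then show "x = comb mul n (c x) (\<lambda>v. v) ?F" using cF[OF x] by simp
  qed (use cF x in blast)
  then show thesis using that[of ?F] cF X(1) by blast
qed

text \<open>
  The generators involve only a finite part \<open>F\<close> of the basis; a further basis element would lie in
  the span of \<open>F\<close>, where its own coordinate functional vanishes.
\<close>

lemma finite_basis_of_finitely_generated:
  assumes G: "is_basis (V n) (mod_span (V n) X) G" and X: "finite X" "X \<subseteq> carrier_vec n"
  shows "finite G"
proof -
  have XM: "X \<subseteq> mod_span (V n) X" by (rule mod_span_superset[OF X(2)])
  obtain F where F: "finite F" "F \<subseteq> G"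
    "\<And>x. x \<in> X \<Longrightarrow> \<exists>c. (\<forall>t. t \<notin> F \<longrightarrow> c t = 0) \<and> x = comb mul n c (\<lambda>v. v) F"
    using basis_finite_support[OF G X(1) XM] by metis
  have Gc: "G \<subseteq> carrier_vec n" using G by (simp add: is_basis_def)
  have "X \<subseteq> mod_span (V n) F"
    using F Gc by (auto simp: mod_span_vec) (metis order_refl)
  then have span: "mod_span (V n) X \<subseteq> mod_span (V n) F"
    using F Gc by (intro mod_span_minimal is_submodule_mod_span) auto
  have "g \<in> F" if g: "g \<in> G" for g
  proof (rule ccontr)
    assume gF: "g \<notin> F"
    obtain \<phi> where \<phi>: "functional mul (mod_span (V n) X) \<phi>"
      "\<And>s. s \<in> G \<Longrightarrow> \<phi> s = (if s = g then 1 else 0)"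
      using basis_functional[OF G, of "\<lambda>s. if s = g then 1 else 0"] by metis
    have FX: "mod_span (V n) F \<subseteq> mod_span (V n) X"
      using mod_span_mono[OF F(2) Gc] G by (simp add: is_basis_def)
    have "\<phi> g = 0"
    proof (rule functional_zero_on_basis[OF is_basis_of_subset[OF G F(2)]])
      show "functional mul (mod_span (V n) F) \<phi>" by (rule functional_mono[OF \<phi>(1) FX])
      show "g \<in> mod_span (V n) F" using g span is_basis_subset[OF G] by blast
      show "\<phi> s = 0" if "s \<in> F" for s using \<phi>(2)[of s] that gF F(2) by auto
    qed
    then show False using \<phi>(2)[OF g] by simp
  qed
  then have "G \<subseteq> F" by blast
  then show ?thesis by (rule finite_subset[OF _ F(1)])
qed

section \<open>The dual as the module of evaluations\<close>

text \<open>
  A functional can be multiplied by scalars on the side that \<open>mul\<close> leaves free, so the dual module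
  and its image under evaluation are modules over the opposite side.
\<close>

lemma evaluations_submodule:
  "is_submodule (vec_module (\<lambda>a b. mul b a) m) (evaluations mul M m q)"
  unfolding ring_mult.is_submodule_iff[OF opposite]
proof (intro conjI ballI allI)
  show "evaluations mul M m q \<subseteq> carrier_vec m" by (auto simp: evaluations_def)
  have "functional mul M (\<lambda>_. 0)" by (simp add: functional_def)
  then show "0\<^sub>v m \<in> evaluations mul M m q"
    unfolding evaluations_def by (auto intro!: exI[of _ "\<lambda>_. 0"])
next
  fix u v assume "u \<in> evaluations mul M m q" "v \<in> evaluations mul M m q"
  then obtain \<phi> \<psi> where "functional mul M \<phi>" "u = vec m (\<lambda>j. \<phi> (q j))"
    "functional mul M \<psi>" "v = vec m (\<lambda>j. \<psi> (q j))"
    by (auto simp: evaluations_def)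
  moreover from this have "functional mul M (\<lambda>v. \<phi> v + \<psi> v)"
    by (simp add: functional_def mul_add_right ac_simps)
  ultimately show "u + v \<in> evaluations mul M m q"
    unfolding evaluations_def by (auto intro!: exI[of _ "\<lambda>v. \<phi> v + \<psi> v"])
next
  fix a v assume "v \<in> evaluations mul M m q"
  then obtain \<phi> where "functional mul M \<phi>" "v = vec m (\<lambda>j. \<phi> (q j))"
    by (auto simp: evaluations_def)
  moreover from this have "functional mul M (\<lambda>v. mul (\<phi> v) a)"
    by (simp add: functional_def mul_add_left mul_assoc)
  ultimately show "map_vec (\<lambda>b. mul b a) v \<in> evaluations mul M m q"
    unfolding evaluations_def by (auto intro!: exI[of _ "\<lambda>v. mul (\<phi> v) a"])
qed

text \<open>
  A functional on a free factor extends to the whole module: put it equal to zero on the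
  complementary basis elements.
\<close>

lemma evaluations_free_factor:
  assumes ff: "free_factor (V n) K M" and q: "\<And>j. j < m \<Longrightarrow> q j \<in> K"
  shows "evaluations mul K m q = evaluations mul M m q"
proof -
  obtain S T where S: "is_basis (V n) K S" and T: "is_basis (V n) M T" and ST: "S \<subseteq> T"
    using ff by (auto simp: free_factor_def)
  have KM: "K \<subseteq> M" by (rule free_factor_subset[OF ff])
  have "\<exists>\<psi>. functional mul M \<psi> \<and> (\<forall>v\<in>K. \<psi> v = \<phi> v)" if \<phi>: "functional mul K \<phi>" for \<phi>
  proof -
    obtain \<psi> where \<psi>: "functional mul M \<psi>" "\<And>t. t \<in> T \<Longrightarrow> \<psi> t = (if t \<in> S then \<phi> t else 0)"
      using basis_functional[OF T, of "\<lambda>t. if t \<in> S then \<phi> t else 0"] by metis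
    have "\<psi> v = \<phi> v" if "v \<in> K" for v
      by (rule functional_eq_on_basis[OF S functional_mono[OF \<psi>(1) KM] \<phi>]) (use \<psi>(2) ST that in auto)
    then show ?thesis using \<psi>(1) by blast
  qed
  moreover have "vec m (\<lambda>j. \<phi> (q j)) = vec m (\<lambda>j. \<psi> (q j))" if "\<forall>v\<in>K. \<psi> v = \<phi> v" for \<phi> \<psi>
    using that q by auto
  ultimately show ?thesis
    unfolding evaluations_def using functional_mono[OF _ KM] by blast
qed

text \<open>
  The value of \<open>\<phi>\<close> at \<open>q j\<close> is the combination of the coordinates \<open>b i $ j\<close> with the coefficients
  \<open>\<phi> (f i)\<close>, which can be prescribed arbitrarily because the \<open>f i\<close> form a basis. This identifies the
  row space of \<open>B\<close> in \<open>Q = F B\<close>.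
\<close>

lemma evaluations_eq_coordinate_span:
  assumes f: "is_basis (V n) M (f ` I)" "inj_on f I" and fin: "finite I"
    and b: "\<And>i. i \<in> I \<Longrightarrow> b i \<in> carrier_vec m"
    and q: "\<And>j. j < m \<Longrightarrow> q j = comb mul n (\<lambda>i. b i $ j) f I"
  shows "mod_span (vec_module (\<lambda>a b. mul b a) m) (b ` I) = evaluations mul M m q"
proof
  interpret op: ring_mult "\<lambda>a b. mul b a" by (rule opposite)
  have M: "is_submodule (V n) M" by (rule is_basis_submodule[OF f(1)])
  have fM: "f i \<in> M" if "i \<in> I" for i using is_basis_subset[OF f(1)] that by auto
  have bI: "b ` I \<subseteq> carrier_vec m" using b by auto
  have eval: "vec m (\<lambda>j. \<phi> (q j)) = comb (\<lambda>a b. mul b a) m (\<lambda>i. \<phi> (f i)) b I"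
    if "functional mul M \<phi>" for \<phi>
    using functional_comb[OF M that fin fM] q by (intro eq_vecI) auto
  have "b i \<in> mod_span (vec_module (\<lambda>a b. mul b a) m) (b ` I)" if "i \<in> I" for i
    using op.mod_span_superset[OF bI] that by blast
  then have "vec m (\<lambda>j. \<phi> (q j)) \<in> mod_span (vec_module (\<lambda>a b. mul b a) m) (b ` I)"
    if "functional mul M \<phi>" for \<phi>
    unfolding eval[OF that] by (rule op.submodule_comb[OF op.is_submodule_mod_span[OF bI] _ fin])
  then show "evaluations mul M m q \<subseteq> mod_span (vec_module (\<lambda>a b. mul b a) m) (b ` I)"
    unfolding evaluations_def by blast
  show "mod_span (vec_module (\<lambda>a b. mul b a) m) (b ` I) \<subseteq> evaluations mul M m q"
  proof (rule op.mod_span_minimal[OF evaluations_submodule], rule image_subsetI)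
    fix i assume i: "i \<in> I"
    obtain \<phi> where \<phi>: "functional mul M \<phi>" "\<And>s. s \<in> f ` I \<Longrightarrow> \<phi> s = (if s = f i then 1 else 0)"
      using basis_functional[OF f(1), of "\<lambda>s. if s = f i then 1 else 0"] by metis
    have "comb (\<lambda>a b. mul b a) m (\<lambda>i. \<phi> (f i)) b I
        = comb (\<lambda>a b. mul b a) m (\<lambda>j. if j = i then 1 else 0) b I"
      using \<phi>(2) f(2) i by (intro comb_cong) (auto dest: inj_onD)
    also have "\<dots> = b i" by (rule op.comb_delta[where w=b, OF fin i b[OF i]])
    finally have "b i = vec m (\<lambda>j. \<phi> (q j))" using eval[OF \<phi>(1)] by simp
    then show "b i \<in> evaluations mul M m q" using \<phi>(1) unfolding evaluations_def by blast
  qed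
qed

end

text \<open>
  A side-independent form of the choices in the definition of the \<open>Q\<close>-dual: \<open>q j\<close> stands for the
  columns (or rows) of \<open>Q\<close>, and \<open>b l\<close> for the rows of \<open>B\<close> (or columns of \<open>C\<close>).
\<close>

definition is_dual :: "('a::ring_1 \<Rightarrow> 'a \<Rightarrow> 'a) \<Rightarrow> nat \<Rightarrow> nat \<Rightarrow> (nat \<Rightarrow> 'a vec) \<Rightarrow> 'a vec set \<Rightarrow>
    'a vec list \<Rightarrow> (nat \<Rightarrow> 'a vec) \<Rightarrow> 'a vec set \<Rightarrow> bool" where
  "is_dual mul n m q M fs b D \<longleftrightarrow>
     (\<exists>K. free_factor (vec_module mul n) K M \<and> mod_span (vec_module mul n) (q ` {..<m}) \<subseteq> K \<and>
        distinct fs \<and> is_basis (vec_module mul n) K (set fs)) \<and>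
     (\<forall>l<length fs. b l \<in> carrier_vec m) \<and>
     (\<forall>j<m. q j = comb mul n (\<lambda>l. b l $ j) (\<lambda>l. fs ! l) {..<length fs}) \<and>
     D = mod_span (vec_module (\<lambda>a b. mul b a) m) (b ` {..<length fs})"

context ring_mult
begin

lemma is_dual_unique:
  assumes M: "is_submodule (V n) M" and q: "\<And>j. j < m \<Longrightarrow> q j \<in> M" and D: "is_dual mul n m q M fs b D"
  shows "D = evaluations mul M m q"
proof -
  obtain K where K: "free_factor (V n) K M" "mod_span (V n) (q ` {..<m}) \<subseteq> K" "distinct fs"
    "is_basis (V n) K (set fs)" and b: "\<forall>l<length fs. b l \<in> carrier_vec m"
    and qb: "\<forall>j<m. q j = comb mul n (\<lambda>l. b l $ j) (\<lambda>l. fs ! l) {..<length fs}"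
    and D: "D = mod_span (vec_module (\<lambda>a b. mul b a) m) (b ` {..<length fs})"
    using D unfolding is_dual_def by blast
  have "q ` {..<m} \<subseteq> carrier_vec n" using q M by (auto simp: is_submodule_iff)
  then have qK: "q j \<in> K" if "j < m" for j
    using K(2) mod_span_superset[of "q ` {..<m}" n] that by auto
  have fs: "(\<lambda>l. fs ! l) ` {..<length fs} = set fs" by (auto simp: set_conv_nth)
  have "D = evaluations mul K m q"
    unfolding D
    by (rule evaluations_eq_coordinate_span[where f="\<lambda>l. fs ! l" and n=n])
      (use K(3,4) b qb in \<open>auto simp: fs inj_on_def nth_eq_iff_index_eq\<close>)
  then show ?thesis using evaluations_free_factor[OF K(1), of m q] qK by simp
qed

end

section \<open>Submodules over a free ideal ring\<close>

text \<open>
  For \<open>mul = (*)\<close> the submodules of the regular module are the left ideals, for the opposite product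
  the right ideals.
\<close>

locale free_left_ideals = ring_mult +
  assumes ideals_free: "is_submodule (regular_module mul) I \<Longrightarrow> is_free (regular_module mul) I"
begin

text \<open>
  The image of \<open>\<phi>\<close> is an ideal and hence free; preimages of its basis represent a basis of \<open>M\<close>
  modulo the kernel.
\<close>

lemma kernel_basis_extends:
  assumes M: "is_submodule (V n) M" and \<phi>: "functional mul M \<phi>"
    and S: "is_basis (V n) {v \<in> M. \<phi> v = 0} S"
  obtains U where "is_basis (V n) M (S \<union> U)"
proof -
  let ?R = "regular_module mul"
  obtain J where J: "is_basis ?R (\<phi> ` M) J"
    using ideals_free[OF image_ideal[OF M \<phi>]] by (auto simp: is_free_def)
  have indep: "c y = 0" if "finite F" "F \<subseteq> J" "(\<Sum>y\<in>F. mul (c y) y) = 0" "y \<in> F" for c F y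
  proof -
    have "lin_comb ?R c F = zero ?R" using that lin_comb_regular by (simp add: regular_module_def)
    then show ?thesis using J that unfolding is_basis_def lin_indep_def by blast
  qed
  have "\<phi> ` M = {lin_comb ?R c F | c F. finite F \<and> F \<subseteq> J}"
    using J by (simp add: is_basis_def mod_span_def)
  also have "\<dots> = {\<Sum>y\<in>F. mul (c y) y | c F. finite F \<and> F \<subseteq> J}"
    by (intro Collect_cong iff_exI) (auto simp: lin_comb_regular)
  finally have span: "\<phi> ` M = {\<Sum>y\<in>F. mul (c y) y | c F. finite F \<and> F \<subseteq> J}" .
  have JM: "J \<subseteq> \<phi> ` M"
  proof
    fix y assume y: "y \<in> J"
    have "\<exists>c F. y = (\<Sum>z\<in>F. mul (c z) z) \<and> finite F \<and> F \<subseteq> J"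
      by (rule exI[where x = "\<lambda>_. 1"], rule exI[where x = "{y}"]) (simp add: y)
    then show "y \<in> \<phi> ` M" unfolding span by (rule CollectI)
  qed
  define u where "u = inv_into M \<phi>"
  have u: "u y \<in> M" "\<phi> (u y) = y" if "y \<in> J" for y
    using that JM by (auto simp: u_def inv_into_into f_inv_into_f)
  have inj: "inj_on u J" unfolding u_def by (rule inj_on_inv_into[OF JM])
  have "is_basis (V n) M (S \<union> u ` J)"
  proof (rule is_basis_union[OF M S])
    show "u ` J \<subseteq> M" using u by auto
    fix c F v assume F: "finite F" "F \<subseteq> u ` J" "comb mul n c (\<lambda>v. v) F \<in> {v \<in> M. \<phi> v = 0}" "v \<in> F"
    obtain G where G: "G \<subseteq> J" "F = u ` G" using F(2) by (meson subset_imageE)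
    have injG: "inj_on u G" using inj G(1) inj_on_subset by blast
    have finG: "finite G" using F(1) G(2) injG finite_imageD by blast
    have "\<phi> (comb mul n (\<lambda>y. c (u y)) u G) = (\<Sum>y\<in>G. mul (c (u y)) (\<phi> (u y)))"
      by (rule functional_comb[OF M \<phi> finG]) (use u G in auto)
    moreover have "(\<Sum>y\<in>G. mul (c (u y)) (\<phi> (u y))) = (\<Sum>y\<in>G. mul (c (u y)) y)"
      using u G by (intro sum.cong) auto
    ultimately have "(\<Sum>y\<in>G. mul (c (u y)) y) = 0"
      using F(3) unfolding G(2) comb_image[OF injG] by simp
    then show "c v = 0" using indep[OF finG G(1), of "\<lambda>y. c (u y)"] F(4) G(2) by auto
  next
    fix v assume v: "v \<in> M"
    then have "\<phi> v \<in> \<phi> ` M" by blast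
    then obtain c F where F: "finite F" "F \<subseteq> J" "\<phi> v = (\<Sum>y\<in>F. mul (c y) y)" unfolding span by blast
    let ?w = "comb mul n c u F"
    have uF: "\<And>y. y \<in> F \<Longrightarrow> u y \<in> M" using u F by auto
    have wM: "?w \<in> M" by (rule submodule_comb[OF M uF F(1)])
    have "\<phi> ?w = (\<Sum>y\<in>F. mul (c y) (\<phi> (u y)))" by (rule functional_comb[OF M \<phi> F(1) uF])
    also have "\<dots> = \<phi> v" unfolding F(3) using u F(2) by (intro sum.cong) auto
    finally have \<phi>w: "\<phi> ?w = \<phi> v" .
    let ?m = "map_vec (mul (- 1)) ?w"
    have mM: "?m \<in> M" using M wM by (simp add: is_submodule_iff)
    have "\<phi> (v + ?m) = \<phi> v + mul (- 1) (\<phi> ?w)" using \<phi> v mM wM by (simp add: functional_def)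
    then have "\<phi> (v + ?m) = 0" by (simp add: \<phi>w mul_minus_left)
    moreover have "v + ?m \<in> M" using M v mM by (simp add: is_submodule_iff)
    moreover have "v = (v + ?m) + ?w"
    proof -
      have "v \<in> carrier_vec n" using M v by (auto simp: is_submodule_iff)
      then show ?thesis by (intro eq_vecI) (auto simp: mul_minus_left)
    qed
    moreover have "?w \<in> mod_span (V n) (u ` J)"
    proof -
      have c: "u ` J \<subseteq> carrier_vec n" using M u by (auto simp: is_submodule_iff)
      show ?thesis
        by (rule submodule_comb[OF is_submodule_mod_span[OF c]]) (use mod_span_superset[OF c] F in auto)
    qed
    ultimately show "\<exists>k\<in>{v \<in> M. \<phi> v = 0}. \<exists>w\<in>mod_span (V n) (u ` J). v = k + w" by blast
  qed auto
  then show thesis using that by blast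
qed

text \<open>
  Let \<open>L j\<close> consist of the vectors of \<open>M\<close> supported in the first \<open>j\<close> coordinates. Then \<open>L j\<close> is
  the kernel on \<open>L (Suc j)\<close> of the \<open>j\<close>-th coordinate, so its basis extends to one of \<open>L (Suc j)\<close>.
\<close>

theorem submodule_free:
  assumes M: "is_submodule (V n) M"
  shows "is_free (V n) M"
proof -
  define L where "L j = {v \<in> M. \<forall>i<n. j \<le> i \<longrightarrow> v $ i = 0}" for j
  have L: "is_submodule (V n) (L j)" for j
    using M unfolding is_submodule_iff L_def by (auto simp: subset_iff)
  have "is_free (V n) (L j)" if "j \<le> n" for j
    using that
  proof (induction j)
    case 0
    have "L 0 = {0\<^sub>v n}" using M by (auto simp: L_def is_submodule_iff intro!: eq_vecI)
    moreover have "is_basis (V n) {0\<^sub>v n} {}"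
      by (auto simp: is_basis_def lin_indep_vec mod_span_vec comb_empty)
    ultimately show ?case by (auto simp: is_free_def)
  next
    case (Suc j)
    have \<phi>: "functional mul (L (Suc j)) (\<lambda>v. v $ j)"
      using Suc.prems by (intro functional_index[OF L]) auto
    have "{v \<in> L (Suc j). v $ j = 0} = L j"
    proof -
      have "j \<le> i \<longleftrightarrow> Suc j \<le> i \<or> i = j" for i by auto
      then show ?thesis using Suc.prems unfolding L_def by fastforce
    qed
    then obtain S where "is_basis (V n) {v \<in> L (Suc j). v $ j = 0} S"
      using Suc by (auto simp: is_free_def)
    then show ?case using kernel_basis_extends[OF L \<phi>] by (metis is_free_def)
  qed
  moreover have "L n = M" by (auto simp: L_def)
  ultimately show ?thesis by auto
qed

text \<open>
  The kernel of a nonzero functional on \<open>L\<close> is a proper free factor, and conversely a proper free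
  factor is annihilated by the coordinate functional of a complementary basis element.
\<close>

lemma algebraic_ext_iff:
  assumes R: "is_submodule (V n) R" and L: "is_submodule (V n) L" and RL: "R \<subseteq> L"
  shows "algebraic_ext (V n) R L \<longleftrightarrow>
    (\<forall>\<phi>. functional mul L \<phi> \<and> (\<forall>v\<in>R. \<phi> v = 0) \<longrightarrow> (\<forall>v\<in>L. \<phi> v = 0))"
proof
  assume alg: "algebraic_ext (V n) R L"
  show "\<forall>\<phi>. functional mul L \<phi> \<and> (\<forall>v\<in>R. \<phi> v = 0) \<longrightarrow> (\<forall>v\<in>L. \<phi> v = 0)"
  proof (intro allI impI, elim conjE)
    fix \<phi> assume \<phi>: "functional mul L \<phi>" and zero: "\<forall>v\<in>R. \<phi> v = 0"
    let ?K = "{v \<in> L. \<phi> v = 0}"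
    obtain S where S: "is_basis (V n) ?K S"
      using submodule_free[OF kernel_submodule[OF L \<phi>]] by (auto simp: is_free_def)
    obtain U where "is_basis (V n) L (S \<union> U)" by (rule kernel_basis_extends[OF L \<phi> S])
    then have "free_factor (V n) ?K L" using S unfolding free_factor_def by blast
    moreover have "R \<subseteq> ?K" using RL zero by auto
    ultimately show "\<forall>v\<in>L. \<phi> v = 0" using alg unfolding algebraic_ext_def by auto
  qed
next
  assume func: "\<forall>\<phi>. functional mul L \<phi> \<and> (\<forall>v\<in>R. \<phi> v = 0) \<longrightarrow> (\<forall>v\<in>L. \<phi> v = 0)"
  have "\<not> (free_factor (V n) K L \<and> R \<subseteq> K \<and> K \<subset> L)" for K
  proof
    assume K: "free_factor (V n) K L \<and> R \<subseteq> K \<and> K \<subset> L"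
    then obtain S T where S: "is_basis (V n) K S" and T: "is_basis (V n) L T" and ST: "S \<subseteq> T"
      by (auto simp: free_factor_def)
    have "S \<noteq> T" using K S T by (auto simp: is_basis_def)
    then obtain t where t: "t \<in> T" "t \<notin> S" using ST by auto
    obtain \<phi> where \<phi>: "functional mul L \<phi>" "\<And>s. s \<in> T \<Longrightarrow> \<phi> s = (if s = t then 1 else 0)"
      using basis_functional[OF T, of "\<lambda>s. if s = t then 1 else 0"] by metis
    have KL: "K \<subseteq> L" using K by auto
    have \<phi>S: "\<phi> s = 0" if "s \<in> S" for s using \<phi>(2)[of s] ST t(2) that by auto
    have "\<phi> v = 0" if "v \<in> K" for v
      by (rule functional_zero_on_basis[OF S functional_mono[OF \<phi>(1) KL] \<phi>S that])
    then have "\<phi> t = 0" using func \<phi>(1) K t is_basis_subset[OF T] by blast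
    then show False using \<phi>(2)[OF t(1)] by simp
  qed
  then show "algebraic_ext (V n) R L" using assms by (auto simp: algebraic_ext_def)
qed

text \<open>
  The coordinate functionals of \<open>M\<close> complementary to \<open>K\<close> vanish on \<open>R\<close>, hence on \<open>L\<close>, so vectors of
  \<open>L\<close> have coordinates only along \<open>K\<close>. Taking for \<open>K\<close> a second algebraic closure gives uniqueness.
\<close>

lemma algebraic_ext_le_free_factor:
  assumes alg: "algebraic_ext (V n) R L" and ff: "free_factor (V n) K M" and "R \<subseteq> K" "L \<subseteq> M"
  shows "L \<subseteq> K"
proof
  fix v assume v: "v \<in> L"
  obtain S T where S: "is_basis (V n) K S" and T: "is_basis (V n) M T" and ST: "S \<subseteq> T"
    using ff by (auto simp: free_factor_def)
  have sub: "is_submodule (V n) R" "is_submodule (V n) L" "R \<subseteq> L"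
    using alg by (auto simp: algebraic_ext_def)
  have M: "is_submodule (V n) M" by (rule is_basis_submodule[OF T])
  obtain c F where F: "finite F" "F \<subseteq> T" "v = comb mul n c (\<lambda>v. v) F"
    using basis_comb[OF T, of v] v assms by blast
  have FM: "\<And>x. x \<in> F \<Longrightarrow> x \<in> M" using F is_basis_subset[OF T] by auto
  have "c t = 0" if t: "t \<in> F - S" for t
  proof -
    obtain \<phi> where \<phi>: "functional mul M \<phi>" "\<And>s. s \<in> T \<Longrightarrow> \<phi> s = (if s = t then 1 else 0)"
      using basis_functional[OF T, of "\<lambda>s. if s = t then 1 else 0"] by metis
    have KM: "K \<subseteq> M" by (rule free_factor_subset[OF ff])
    have \<phi>S: "\<phi> s = 0" if "s \<in> S" for s using \<phi>(2)[of s] ST t that by auto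
    have "\<phi> w = 0" if "w \<in> K" for w
      by (rule functional_zero_on_basis[OF S functional_mono[OF \<phi>(1) KM] \<phi>S that])
    then have "\<phi> v = 0"
      using algebraic_ext_iff[OF sub] alg functional_mono[OF \<phi>(1) assms(4)] assms(3) v by blast
    moreover have "\<phi> v = (\<Sum>x\<in>F. mul (c x) (\<phi> x))"
      unfolding F(3) by (rule functional_comb[OF M \<phi>(1) F(1) FM])
    moreover have "\<dots> = (\<Sum>x\<in>F. if x = t then c x else 0)"
      using \<phi>(2) F(2) by (intro sum.cong) auto
    ultimately show ?thesis using F(1) t by simp
  qed
  then have "v = comb mul n c (\<lambda>v. v) (F \<inter> S)"
    unfolding F(3) by (intro comb_mono_neutral) (use F in auto)
  then show "v \<in> K"
    using submodule_comb[OF is_basis_submodule[OF S], of "F \<inter> S" "\<lambda>v. v" c] F is_basis_subset[OF S]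
    by auto
qed

lemma algebraic_closure_eqI:
  assumes "algebraic_ext (V n) R L" "free_factor (V n) L M"
  shows "algebraic_closure (V n) R M = L"
  unfolding algebraic_closure_def
proof (rule the_equality)
  fix K assume K: "algebraic_ext (V n) R K \<and> free_factor (V n) K M"
  have "R \<subseteq> K" "R \<subseteq> L" using K assms by (auto simp: algebraic_ext_def)
  moreover have "K \<subseteq> M" "L \<subseteq> M" using K assms free_factor_subset[of n _ M] by auto
  ultimately show "K = L"
    using algebraic_ext_le_free_factor[of n R K L M] algebraic_ext_le_free_factor[of n R L K M]
      K assms by auto
qed (use assms in simp)

lemma is_dual_exists:
  assumes M: "is_submodule (V n) M" and q: "\<And>j. j < m \<Longrightarrow> q j \<in> M"
  shows "\<exists>fs b. is_dual mul n m q M fs b (evaluations mul M m q)"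
proof -
  obtain T where T: "is_basis (V n) M T" using submodule_free[OF M] by (auto simp: is_free_def)
  have "finite (q ` {..<m})" "q ` {..<m} \<subseteq> M" using q by auto
  then obtain F where F: "finite F" "F \<subseteq> T"
    and c: "\<And>x. x \<in> q ` {..<m} \<Longrightarrow> \<exists>c. (\<forall>t. t \<notin> F \<longrightarrow> c t = 0) \<and> x = comb mul n c (\<lambda>v. v) F"
    using basis_finite_support[OF T] by metis
  have "\<exists>c. q j = comb mul n c (\<lambda>v. v) F" if "j < m" for j using c[of "q j"] that by auto
  then obtain c where c: "\<And>j. j < m \<Longrightarrow> q j = comb mul n (c j) (\<lambda>v. v) F" by metis
  obtain fs where fs: "set fs = F" "distinct fs" using finite_distinct_list[OF F(1)] by blast
  have im: "(\<lambda>l. fs ! l) ` {..<length fs} = F" using fs by (auto simp: set_conv_nth)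
  have inj: "inj_on (\<lambda>l. fs ! l) {..<length fs}" using fs by (auto simp: inj_on_def nth_eq_iff_index_eq)
  define b where "b l = vec m (\<lambda>j. c j (fs ! l))" for l
  have Fbasis: "is_basis (V n) (mod_span (V n) F) F" by (rule is_basis_of_subset[OF T F(2)])
  have "free_factor (V n) (mod_span (V n) F) M"
    using Fbasis T F(2) unfolding free_factor_def by blast
  moreover have "mod_span (V n) (q ` {..<m}) \<subseteq> mod_span (V n) F"
  proof (rule mod_span_minimal[OF is_basis_submodule[OF Fbasis]], rule image_subsetI)
    fix j assume "j \<in> {..<m}"
    then show "q j \<in> mod_span (V n) F"
      using c[of j] submodule_comb[OF is_basis_submodule[OF Fbasis], of F "\<lambda>v. v" "c j"] F(1)
        is_basis_subset[OF Fbasis] by auto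
  qed
  moreover have "q j = comb mul n (\<lambda>l. b l $ j) (\<lambda>l. fs ! l) {..<length fs}" if "j < m" for j
  proof -
    have "comb mul n (\<lambda>l. b l $ j) (\<lambda>l. fs ! l) {..<length fs}
        = comb mul n (\<lambda>l. c j (fs ! l)) (\<lambda>l. fs ! l) {..<length fs}"
      using that by (intro comb_cong) (auto simp: b_def)
    then show ?thesis using comb_image[OF inj, of mul n "c j"] c[OF that] by (simp add: im)
  qed
  ultimately have dual: "is_dual mul n m q M fs b (mod_span (vec_module (\<lambda>a b. mul b a) m) (b ` {..<length fs}))"
    unfolding is_dual_def using Fbasis fs by (auto simp: b_def)
  have "is_dual mul n m q M fs b (evaluations mul M m q)"
    using dual is_dual_unique[OF M q dual] by simp
  then show ?thesis by blast
qed

lemma the_is_dual: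
  assumes "is_submodule (V n) M" and "\<And>j. j < m \<Longrightarrow> q j \<in> M"
  shows "(THE D. \<exists>fs b. is_dual mul n m q M fs b D) = evaluations mul M m q"
proof (rule the_equality)
  show "\<exists>fs b. is_dual mul n m q M fs b (evaluations mul M m q)" by (rule is_dual_exists[OF assms])
qed (elim exE, rule is_dual_unique[OF assms])

end

section \<open>The double dual\<close>

locale free_one_sided_ideals = free_left_ideals +
  assumes ideals_free_opposite: "is_submodule (regular_module (\<lambda>a b. mul b a)) I \<Longrightarrow>
    is_free (regular_module (\<lambda>a b. mul b a)) I"
begin

lemma free_left_ideals_opposite: "free_left_ideals (\<lambda>a b. mul b a)"
  by (intro free_left_ideals.intro opposite free_left_ideals_axioms.intro ideals_free_opposite)

text \<open>
  The dual of \<open>N\<close> is again given by evaluations, now of functionals on \<open>N\<close> at the rows of the matrix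
  \<open>q\<close>. A basis \<open>G\<close> of \<open>N\<close> indexes both the columns \<open>c g\<close> of the matrix \<open>C\<close> in \<open>Q = C G\<close> and
  functionals \<open>\<phi> g\<close> on \<open>M\<close> with row of values \<open>g\<close>. Independence of \<open>G\<close> makes these two families
  dual to each other, which splits \<open>L\<close> off \<open>M\<close>, and it lets no nonzero functional on \<open>L\<close> vanish on
  all columns of \<open>q\<close>.
\<close>

theorem double_dual:
  fixes q :: "nat \<Rightarrow> nat \<Rightarrow> 'a" and k m :: nat
  defines "cvec \<equiv> \<lambda>j. vec k (\<lambda>i. q i j)" and "rvec \<equiv> \<lambda>i. vec m (\<lambda>j. q i j)"
  assumes M: "is_submodule (V k) M" and cM: "cvec ` {..<m} \<subseteq> M"
  defines "N \<equiv> evaluations mul M m cvec"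
  defines "L \<equiv> evaluations (\<lambda>a b. mul b a) N k rvec"
  shows "is_submodule (vec_module (\<lambda>a b. mul b a) m) N" "\<And>i. i < k \<Longrightarrow> rvec i \<in> N"
    and "algebraic_ext (V k) (mod_span (V k) (cvec ` {..<m})) L" "free_factor (V k) L M"
proof -
  let ?op = "\<lambda>a b. mul b a"
  have colM: "cvec j \<in> M" if "j < m" for j using cM that by auto
  interpret op: free_left_ideals ?op by (rule free_left_ideals_opposite)
  show N: "is_submodule (vec_module ?op m) N"
    unfolding N_def by (rule evaluations_submodule)
  \<comment> \<open>The rows of the matrix are the values of the coordinate functionals.\<close>
  show rowN: "rvec i \<in> N" if i: "i < k" for i
  proof -
    have "rvec i = vec m (\<lambda>j. cvec j $ i)" using i by (auto simp: rvec_def cvec_def)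
    then have "\<exists>\<phi>. rvec i = vec m (\<lambda>j. \<phi> (cvec j)) \<and> functional mul M \<phi>"
      using functional_index[OF M i] by (intro exI[where x = "\<lambda>v. v $ i"]) simp
    then show ?thesis unfolding N_def evaluations_def by (rule CollectI)
  qed
  have L: "is_submodule (V k) L"
    unfolding L_def by (rule op.evaluations_submodule)
  obtain fs b where dual: "is_dual mul k m cvec M fs b N"
    using is_dual_exists[of k M m cvec] M colM unfolding N_def by blast
  then obtain K where K: "free_factor (V k) K M" "is_basis (V k) K (set fs)"
    unfolding is_dual_def by blast
  let ?I = "{..<length fs}"
  have b: "\<And>l. l < length fs \<Longrightarrow> b l \<in> carrier_vec m"
    and colb: "\<And>j. j < m \<Longrightarrow> cvec j = comb mul k (\<lambda>l. b l $ j) (\<lambda>l. fs ! l) ?I"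
    and Nspan: "N = mod_span (vec_module ?op m) (b ` ?I)"
    using dual unfolding is_dual_def by auto
  have bI: "b ` ?I \<subseteq> carrier_vec m" using b by auto
  have bN: "b l \<in> N" if "l \<in> ?I" for l using op.mod_span_superset[OF bI] that Nspan by auto
  have fsM: "fs ! l \<in> M" if "l < length fs" for l
    using free_factor_subset[OF K(1)] is_basis_subset[OF K(2)] nth_mem[OF that] by blast
  \<comment> \<open>In matrix form, \<open>\<psi>(Q) = F \<psi>(B)\<close> for \<open>Q = F B\<close> and a functional \<open>\<psi>\<close> on \<open>N\<close>.\<close>
  have LM: "L \<subseteq> M"
  proof
    fix v assume "v \<in> L"
    then obtain \<psi> where \<psi>: "functional ?op N \<psi>" "v = vec k (\<lambda>i. \<psi> (rvec i))"
      by (auto simp: L_def evaluations_def)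
    have "\<psi> (rvec i) = (\<Sum>l\<in>?I. mul (\<psi> (b l)) (fs ! l $ i))" if i: "i < k" for i
    proof -
      have "q i j = (\<Sum>l\<in>?I. mul (b l $ j) (fs ! l $ i))" if "j < m" for j
      proof -
        have "q i j = cvec j $ i" using i by (simp add: cvec_def)
        then show ?thesis using colb[OF that] i by simp
      qed
      then have "rvec i = comb ?op m (\<lambda>l. fs ! l $ i) b ?I"
        by (intro eq_vecI) (auto simp: rvec_def)
      then show ?thesis using op.functional_comb[OF N \<psi>(1) finite_lessThan bN, where a = "\<lambda>l. fs ! l $ i"] by simp
    qed
    then have "v = comb mul k (\<lambda>l. \<psi> (b l)) (\<lambda>l. fs ! l) ?I"
      unfolding \<psi>(2) by (intro eq_vecI) auto
    then show "v \<in> M" using submodule_comb[OF M, of ?I "\<lambda>l. fs ! l"] fsM by simp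
  qed
  obtain G where G: "is_basis (vec_module ?op m) N G"
    using op.submodule_free[OF N] by (auto simp: is_free_def)
  have finG: "finite G"
    by (rule op.finite_basis_of_finitely_generated[of m "b ` ?I"]) (use G Nspan bI in auto)
  have GN: "G \<subseteq> N" by (rule op.is_basis_subset[OF G])
  have Gc: "G \<subseteq> carrier_vec m" using G by (simp add: is_basis_def)
  have "\<exists>\<phi>. functional mul M \<phi> \<and> (\<forall>j<m. g $ j = \<phi> (cvec j))" if "g \<in> G" for g
  proof -
    from that GN have "g \<in> N" by blast
    then obtain \<phi> where "functional mul M \<phi>" "g = vec m (\<lambda>j. \<phi> (cvec j))"
      by (auto simp: N_def evaluations_def)
    then show ?thesis by (intro exI[of _ \<phi>]) auto
  qed
  then obtain \<phi> where \<phi>: "\<And>g. g \<in> G \<Longrightarrow> functional mul M (\<phi> g)"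
    and g\<phi>: "\<And>g j. g \<in> G \<Longrightarrow> j < m \<Longrightarrow> g $ j = \<phi> g (cvec j)"
    by metis
  have "\<exists>\<gamma>. rvec i = comb ?op m \<gamma> (\<lambda>g. g) G" if i: "i < k" for i
  proof -
    obtain \<gamma> F where F: "finite F" "F \<subseteq> G" "rvec i = comb ?op m \<gamma> (\<lambda>g. g) F" "\<And>t. t \<notin> F \<Longrightarrow> \<gamma> t = 0"
      using op.basis_comb[OF G rowN[OF i]] by metis
    have "comb ?op m \<gamma> (\<lambda>g. g) G = comb ?op m \<gamma> (\<lambda>g. g) F"
      by (rule op.comb_mono_neutral) (use F finG in auto)
    then show ?thesis using F(3) by metis
  qed
  then obtain \<gamma> where \<gamma>: "\<And>i. i < k \<Longrightarrow> rvec i = comb ?op m (\<gamma> i) (\<lambda>g. g) G" by metis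
  define c where "c g = vec k (\<lambda>i. \<gamma> i g)" for g
  \<comment> \<open>This is \<open>Q = C G\<close>, read off from the expansions of the rows of \<open>Q\<close> in the basis \<open>G\<close>.\<close>
  have colc: "cvec j = comb mul k (\<lambda>g. g $ j) c G" if j: "j < m" for j
  proof (rule eq_vecI)
    fix i assume "i < dim_vec (comb mul k (\<lambda>g. g $ j) c G)"
    then have i: "i < k" by simp
    have "cvec j $ i = rvec i $ j" using i j by (simp add: cvec_def rvec_def)
    then show "cvec j $ i = comb mul k (\<lambda>g. g $ j) c G $ i" using \<gamma>[OF i] i j by (simp add: c_def)
  qed (simp add: cvec_def)
  have Lspan: "mod_span (V k) (c ` G) = L"
    unfolding L_def
  proof (rule op.evaluations_eq_coordinate_span[where f="\<lambda>g. g" and n=m])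
    show "rvec i = comb ?op m (\<lambda>g. c g $ i) (\<lambda>g. g) G" if "i < k" for i
      using \<gamma>[OF that] that by (simp add: c_def)
  qed (use G finG in \<open>auto simp: c_def\<close>)
  have cc: "c ` G \<subseteq> carrier_vec k" by (auto simp: c_def)
  have cL: "c g \<in> L" if "g \<in> G" for g
    using mod_span_superset[OF cc] Lspan that by auto
  have cGM: "c g \<in> M" if "g \<in> G" for g using cL[OF that] LM by auto
  \<comment> \<open>Applying \<open>\<psi>\<close> to \<open>Q = C G\<close> gives \<open>\<psi>(Q) = \<psi>(C) G\<close>.\<close>
  have eval: "vec m (\<lambda>j. \<psi> (cvec j)) = comb ?op m (\<lambda>g. \<psi> (c g)) (\<lambda>g. g) G"
    if "functional mul L \<psi>" for \<psi>
    using functional_comb[OF L that finG cL] colc by (intro eq_vecI) auto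
  have \<phi>L: "functional mul L (\<phi> g)" if "g \<in> G" for g by (rule functional_mono[OF \<phi>[OF that] LM])
  have delta: "\<phi> h (c g) = (if g = h then 1 else 0)" if h: "h \<in> G" and g: "g \<in> G" for g h
  proof -
    have "h = vec m (\<lambda>j. \<phi> h (cvec j))" using g\<phi>[OF h] Gc h by (intro eq_vecI) auto
    also have "\<dots> = comb ?op m (\<lambda>g. \<phi> h (c g)) (\<lambda>g. g) G" by (rule eval[OF \<phi>L[OF h]])
    finally have "comb ?op m (\<lambda>g. \<phi> h (c g)) (\<lambda>g. g) G = h" by simp
    moreover have "comb ?op m (\<lambda>g. if g = h then 1 else 0) (\<lambda>g. g) G = h"
      by (rule op.comb_delta) (use h Gc finG in auto)
    moreover have "h - h = 0\<^sub>v m" using h Gc by auto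
    ultimately have "comb ?op m (\<lambda>g. \<phi> h (c g) - (if g = h then 1 else 0)) (\<lambda>g. g) G = 0\<^sub>v m"
      by (simp only: op.comb_diff)
    then show ?thesis using op.basis_indep[OF G finG order_refl _ g] by fastforce
  qed
  have inj: "inj_on c G"
    using delta by (metis (no_types, lifting) inj_onI zero_neq_one)
  \<comment> \<open>\<open>Z\<close> is the kernel of the projection \<open>v \<mapsto> \<Sum>\<^sub>g c\<^sub>g \<phi>\<^sub>g(v)\<close> of \<open>M\<close> onto \<open>L\<close>.\<close>
  define Z where "Z = {v \<in> M. \<forall>g\<in>G. \<phi> g v = 0}"
  have Z: "is_submodule (V k) Z"
    using M \<phi> functional_zero[OF M \<phi>] unfolding is_submodule_iff functional_def Z_def by auto
  then obtain S where S: "is_basis (V k) Z S" using submodule_free by (auto simp: is_free_def)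
  have \<phi>comb: "\<phi> h (comb mul k a c F) = a h" if "F \<subseteq> G" "h \<in> F" for a F h
  proof -
    have F: "finite F" "\<And>g. g \<in> F \<Longrightarrow> c g \<in> M" using that finG finite_subset cGM by auto
    have h: "h \<in> G" using that by auto
    have "\<phi> h (comb mul k a c F) = (\<Sum>g\<in>F. mul (a g) (\<phi> h (c g)))"
      by (rule functional_comb[OF M \<phi>[OF h] F])
    also have "\<dots> = (\<Sum>g\<in>F. if g = h then a g else 0)"
      using delta[OF h] that by (intro sum.cong) auto
    finally show ?thesis using F that by simp
  qed
  have basis: "is_basis (V k) M (S \<union> c ` G)"
  proof (rule is_basis_union[OF M S])
    show "Z \<subseteq> M" by (auto simp: Z_def)
    show "c ` G \<subseteq> M" using cGM by auto
    fix a F v assume F: "finite F" "F \<subseteq> c ` G" "comb mul k a (\<lambda>v. v) F \<in> Z" "v \<in> F"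
    obtain H where H: "H \<subseteq> G" "F = c ` H" using F(2) by (meson subset_imageE)
    obtain h where h: "h \<in> H" "v = c h" using F(4) H by auto
    have "inj_on c H" using inj H(1) inj_on_subset by blast
    then have "comb mul k (\<lambda>g. a (c g)) c H \<in> Z" using F(3) unfolding H(2) by (simp add: comb_image)
    then show "a v = 0"
      using \<phi>comb[OF H(1) h(1), of "\<lambda>g. a (c g)"] h H(1) by (auto simp: Z_def)
  next
    fix v assume v: "v \<in> M"
    let ?w = "comb mul k (\<lambda>g. \<phi> g v) c G"
    let ?m = "map_vec (mul (- 1)) ?w"
    have wL: "?w \<in> L" by (rule submodule_comb[OF L cL finG])
    then have wM: "?w \<in> M" using LM by auto
    have mM: "?m \<in> M" using M wM by (simp add: is_submodule_iff)
    have "\<phi> g (v + ?m) = 0" if g: "g \<in> G" for g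
    proof -
      have "\<phi> g (v + ?m) = \<phi> g v + mul (- 1) (\<phi> g ?w)"
        using \<phi>[OF g] v mM wM by (simp add: functional_def)
      then show ?thesis using \<phi>comb[OF order_refl g] by (simp add: mul_minus_left)
    qed
    moreover have "v + ?m \<in> M" using M v mM by (simp add: is_submodule_iff)
    ultimately have "v + ?m \<in> Z" by (simp add: Z_def)
    moreover have "v = (v + ?m) + ?w"
    proof -
      have "v \<in> carrier_vec k" using M v by (auto simp: is_submodule_iff)
      then show ?thesis by (intro eq_vecI) (auto simp: mul_minus_left)
    qed
    ultimately show "\<exists>u\<in>Z. \<exists>w\<in>mod_span (V k) (c ` G). v = u + w" using wL Lspan by blast
  qed
  have Lbasis: "is_basis (V k) L (c ` G)"
    using is_basis_of_subset[OF basis, of "c ` G"] Lspan by simp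
  then show "free_factor (V k) L M" using basis unfolding free_factor_def by blast
  have colL: "cvec ` {..<m} \<subseteq> L"
    using colc submodule_comb[OF L cL finG] by auto
  have colk: "cvec ` {..<m} \<subseteq> carrier_vec k" by (auto simp: cvec_def)
  show "algebraic_ext (V k) (mod_span (V k) (cvec ` {..<m})) L"
  proof (subst algebraic_ext_iff)
    show "\<forall>\<psi>. functional mul L \<psi> \<and> (\<forall>v\<in>mod_span (V k) (cvec ` {..<m}). \<psi> v = 0) \<longrightarrow> (\<forall>v\<in>L. \<psi> v = 0)"
    proof (intro allI impI ballI, elim conjE)
      fix \<psi> v assume \<psi>: "functional mul L \<psi>" "\<forall>v\<in>mod_span (V k) (cvec ` {..<m}). \<psi> v = 0"
        and v: "v \<in> L"
      have "\<psi> (cvec j) = 0" if "j < m" for j using \<psi>(2) mod_span_superset[OF colk] that by auto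
      then have "comb ?op m (\<lambda>g. \<psi> (c g)) (\<lambda>g. g) G = 0\<^sub>v m"
        using eval[OF \<psi>(1)] by (metis (mono_tags, lifting) dim_vec eq_vecI index_vec index_zero_vec)
      then have "\<psi> (c g) = 0" if "g \<in> G" for g
        using op.basis_indep[OF G finG order_refl _ that, of "\<lambda>g. \<psi> (c g)"] by simp
      then show "\<psi> v = 0"
        by (intro functional_zero_on_basis[OF Lbasis \<psi>(1) _ v]) auto
    qed
  qed (use L colL colk in \<open>auto intro!: is_submodule_mod_span dest: subsetD[OF mod_span_minimal[OF L colL]]\<close>)
qed

end

lemma free_one_sided_ideals_opposite:
  assumes "free_one_sided_ideals mul"
  shows "free_one_sided_ideals (\<lambda>a b. mul b a)"
proof -
  interpret free_one_sided_ideals mul by (rule assms)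
  show ?thesis
    by (intro free_one_sided_ideals.intro free_left_ideals_opposite free_one_sided_ideals_axioms.intro ideals_free)
qed

section \<open>Matrices over a free ideal ring\<close>

abbreviation right_mult :: "'a::ring_1 \<Rightarrow> 'a \<Rightarrow> 'a" where
  "right_mult \<equiv> (\<lambda>a x. x * a)"

lemma col_module_eq: "col_module k = vec_module right_mult k"
  by (simp add: col_module_def vec_module_def)

lemma row_module_eq: "row_module m = vec_module (*) m"
proof -
  have "(\<lambda>a v. a \<cdot>\<^sub>v v) = (\<lambda>(a::'a) v. map_vec ((*) a) v)"
    by (intro ext) auto
  then show ?thesis
    by (simp add: row_module_def vec_module_def module_vec_def)
qed

lemma free_one_sided_ideals_right_mult:
  assumes "free_ideal_ring TYPE('a::ring_1)"
  shows "free_one_sided_ideals (right_mult :: 'a \<Rightarrow> 'a \<Rightarrow> 'a)"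
proof unfold_locales
  show "is_free (regular_module right_mult) I" if "is_submodule (regular_module right_mult) I" for I :: "'a set"
    using assms that by (simp add: free_ideal_ring_def right_regular_def regular_module_def)
  show "is_free (regular_module (\<lambda>a b. right_mult b a)) I"
    if "is_submodule (regular_module (\<lambda>a b. right_mult b a)) I" for I :: "'a set"
    using assms that by (simp add: free_ideal_ring_def left_regular_def regular_module_def)
qed (simp_all add: algebra_simps)

lemma col_space_eq:
  "col_space Q = mod_span (vec_module right_mult (dim_row Q)) ((\<lambda>j. vec (dim_row Q) (\<lambda>i. Q $$ (i, j))) ` {..<dim_col Q})"
  by (simp add: col_space_def col_module_eq cols_def col_def lessThan_atLeast0)

lemma row_space_eq:
  "row_space Q = mod_span (vec_module (*) (dim_col Q)) ((\<lambda>i. vec (dim_col Q) (\<lambda>j. Q $$ (i, j))) ` {..<dim_row Q})"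
  by (simp add: row_space_def row_module_eq rows_def row_def lessThan_atLeast0)

lemma is_dual_right_iff:
  assumes Q: "Q \<in> carrier_mat k m"
  shows "is_dual_right Q M D \<longleftrightarrow>
    (\<exists>fs b. is_dual right_mult k m (\<lambda>j. vec k (\<lambda>i. Q $$ (i, j))) M fs b D)"
proof
  assume "is_dual_right Q M D"
  then obtain K fs B where *: "free_factor (col_module k) K M" "col_space Q \<subseteq> K" "distinct fs"
    "is_basis (col_module k) K (set fs)" "B \<in> carrier_mat (length fs) m"
    "Q = mat_of_cols k fs * B" "D = row_space B"
    using Q unfolding is_dual_right_def by auto
  have "is_dual right_mult k m (\<lambda>j. vec k (\<lambda>i. Q $$ (i, j))) M fs (\<lambda>l. vec m (\<lambda>j. B $$ (l, j))) D"
    unfolding is_dual_def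
  proof (intro conjI allI impI)
    fix j assume j: "j < m"
    show "vec k (\<lambda>i. Q $$ (i, j)) =
        comb right_mult k (\<lambda>l. vec m (\<lambda>j. B $$ (l, j)) $ j) (\<lambda>l. fs ! l) {..<length fs}"
      using *(5) j unfolding *(6)
      by (intro eq_vecI) (auto simp: scalar_prod_def mat_of_cols_index lessThan_atLeast0)
  qed (use * Q in \<open>auto simp: col_module_eq col_space_eq row_space_eq\<close>)
  then show "\<exists>fs b. is_dual right_mult k m (\<lambda>j. vec k (\<lambda>i. Q $$ (i, j))) M fs b D" by blast
next
  assume "\<exists>fs b. is_dual right_mult k m (\<lambda>j. vec k (\<lambda>i. Q $$ (i, j))) M fs b D"
  then obtain K fs b where *: "free_factor (col_module k) K M" "col_space Q \<subseteq> K" "distinct fs"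
    "is_basis (col_module k) K (set fs)" "\<And>l. l < length fs \<Longrightarrow> b l \<in> carrier_vec m"
    "\<And>j. j < m \<Longrightarrow> vec k (\<lambda>i. Q $$ (i, j)) = comb right_mult k (\<lambda>l. b l $ j) (\<lambda>l. fs ! l) {..<length fs}"
    "D = mod_span (vec_module (*) m) (b ` {..<length fs})"
    using Q unfolding is_dual_def by (auto simp: col_module_eq col_space_eq)
  let ?B = "mat (length fs) m (\<lambda>(l, j). b l $ j)"
  have "Q = mat_of_cols k fs * ?B"
  proof (rule eq_matI)
    fix i j assume "i < dim_row (mat_of_cols k fs * ?B)" "j < dim_col (mat_of_cols k fs * ?B)"
    then have ij: "i < k" "j < m" by auto
    have "Q $$ (i, j) = vec k (\<lambda>i. Q $$ (i, j)) $ i" using ij by simp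
    also have "\<dots> = (\<Sum>l<length fs. fs ! l $ i * b l $ j)" unfolding *(6)[OF ij(2)] using ij by simp
    finally show "Q $$ (i, j) = (mat_of_cols k fs * ?B) $$ (i, j)"
      using ij by (auto simp: scalar_prod_def mat_of_cols_index lessThan_atLeast0)
  qed (use Q in auto)
  moreover have "D = row_space ?B"
  proof -
    have "vec m (\<lambda>j. ?B $$ (l, j)) = b l" if "l < length fs" for l
      using *(5)[OF that] that by (intro eq_vecI) auto
    then have "(\<lambda>l. vec m (\<lambda>j. ?B $$ (l, j))) ` {..<length fs} = b ` {..<length fs}"
      by (intro image_cong) auto
    then show ?thesis unfolding *(7) row_space_eq by simp
  qed
  ultimately show "is_dual_right Q M D"
    unfolding is_dual_right_def using * Q by (intro exI[of _ K] exI[of _ fs] exI[of _ ?B]) auto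
qed

lemma is_dual_left_iff:
  assumes Q: "Q \<in> carrier_mat k m"
  shows "is_dual_left Q N D \<longleftrightarrow>
    (\<exists>gs b. is_dual (*) m k (\<lambda>i. vec m (\<lambda>j. Q $$ (i, j))) N gs b D)"
proof
  assume "is_dual_left Q N D"
  then obtain K gs C where *: "free_factor (row_module m) K N" "row_space Q \<subseteq> K" "distinct gs"
    "is_basis (row_module m) K (set gs)" "C \<in> carrier_mat k (length gs)"
    "Q = C * mat_of_rows m gs" "D = col_space C"
    using Q unfolding is_dual_left_def by auto
  have "is_dual (*) m k (\<lambda>i. vec m (\<lambda>j. Q $$ (i, j))) N gs (\<lambda>l. vec k (\<lambda>i. C $$ (i, l))) D"
    unfolding is_dual_def
  proof (intro conjI allI impI)
    fix i assume i: "i < k"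
    show "vec m (\<lambda>j. Q $$ (i, j)) =
        comb (*) m (\<lambda>l. vec k (\<lambda>i. C $$ (i, l)) $ i) (\<lambda>l. gs ! l) {..<length gs}"
      using *(5) i unfolding *(6)
      by (intro eq_vecI) (auto simp: scalar_prod_def mat_of_rows_index lessThan_atLeast0)
  qed (use * Q in \<open>auto simp: row_module_eq col_space_eq row_space_eq\<close>)
  then show "\<exists>gs b. is_dual (*) m k (\<lambda>i. vec m (\<lambda>j. Q $$ (i, j))) N gs b D" by blast
next
  assume "\<exists>gs b. is_dual (*) m k (\<lambda>i. vec m (\<lambda>j. Q $$ (i, j))) N gs b D"
  then obtain K gs b where *: "free_factor (row_module m) K N" "row_space Q \<subseteq> K" "distinct gs"
    "is_basis (row_module m) K (set gs)" "\<And>l. l < length gs \<Longrightarrow> b l \<in> carrier_vec k"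
    "\<And>i. i < k \<Longrightarrow> vec m (\<lambda>j. Q $$ (i, j)) = comb (*) m (\<lambda>l. b l $ i) (\<lambda>l. gs ! l) {..<length gs}"
    "D = mod_span (vec_module right_mult k) (b ` {..<length gs})"
    using Q unfolding is_dual_def by (auto simp: row_module_eq row_space_eq)
  let ?C = "mat k (length gs) (\<lambda>(i, l). b l $ i)"
  have "Q = ?C * mat_of_rows m gs"
  proof (rule eq_matI)
    fix i j assume "i < dim_row (?C * mat_of_rows m gs)" "j < dim_col (?C * mat_of_rows m gs)"
    then have ij: "i < k" "j < m" by auto
    have "Q $$ (i, j) = vec m (\<lambda>j. Q $$ (i, j)) $ j" using ij by simp
    also have "\<dots> = (\<Sum>l<length gs. b l $ i * gs ! l $ j)" unfolding *(6)[OF ij(1)] using ij by simp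
    finally show "Q $$ (i, j) = (?C * mat_of_rows m gs) $$ (i, j)"
      using ij by (auto simp: scalar_prod_def mat_of_rows_index lessThan_atLeast0)
  qed (use Q in auto)
  moreover have "D = col_space ?C"
  proof -
    have "vec k (\<lambda>i. ?C $$ (i, l)) = b l" if "l < length gs" for l
      using *(5)[OF that] that by (intro eq_vecI) auto
    then have "(\<lambda>l. vec k (\<lambda>i. ?C $$ (i, l))) ` {..<length gs} = b ` {..<length gs}"
      by (intro image_cong) auto
    then show ?thesis unfolding *(7) col_space_eq by simp
  qed
  ultimately show "is_dual_left Q N D"
    unfolding is_dual_left_def using * Q by (intro exI[of _ K] exI[of _ gs] exI[of _ ?C]) auto
qed

theorem theorem1p3:
  fixes Q :: "'a::ring_1 mat" and k m :: nat
  assumes "free_ideal_ring TYPE('a)"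
    and "Q \<in> carrier_mat k m"
  shows "(\<forall>M. is_submodule (col_module k) M \<and> col_space Q \<subseteq> M \<longrightarrow>
            dual_left Q (dual_right Q M) = algebraic_closure (col_module k) (col_space Q) M \<and>
            algebraic_ext (col_module k) (col_space Q) (dual_left Q (dual_right Q M)) \<and>
            free_factor (col_module k) (dual_left Q (dual_right Q M)) M) \<and>
         (\<forall>N. is_submodule (row_module m) N \<and> row_space Q \<subseteq> N \<longrightarrow>
            dual_right Q (dual_left Q N) = algebraic_closure (row_module m) (row_space Q) N \<and>
            algebraic_ext (row_module m) (row_space Q) (dual_right Q (dual_left Q N)) \<and>
            free_factor (row_module m) (dual_right Q (dual_left Q N)) N)"
proof -
  interpret R: free_one_sided_ideals "right_mult :: 'a \<Rightarrow> 'a \<Rightarrow> 'a" by (rule free_one_sided_ideals_right_mult[OF assms(1)])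
  interpret L: free_one_sided_ideals "(*) :: 'a \<Rightarrow> 'a \<Rightarrow> 'a" using free_one_sided_ideals_opposite[OF R.free_one_sided_ideals_axioms] by simp
  let ?col = "\<lambda>j. vec k (\<lambda>i. Q $$ (i, j))" and ?row = "\<lambda>i. vec m (\<lambda>j. Q $$ (i, j))"
  have dims: "dim_row Q = k" "dim_col Q = m" using assms(2) by auto
  have dual_right: "dual_right Q M = evaluations right_mult M m ?col"
    if "is_submodule (col_module k) M" "?col ` {..<m} \<subseteq> M" for M
    unfolding dual_right_def is_dual_right_iff[OF assms(2)]
    by (rule R.the_is_dual) (use that in \<open>auto simp: col_module_eq\<close>)
  have dual_left: "dual_left Q N = evaluations (*) N k ?row"
    if "is_submodule (row_module m) N" "?row ` {..<k} \<subseteq> N" for N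
    unfolding dual_left_def is_dual_left_iff[OF assms(2)]
    by (rule L.the_is_dual) (use that in \<open>auto simp: row_module_eq\<close>)
  have "dual_left Q (dual_right Q M) = algebraic_closure (col_module k) (col_space Q) M \<and>
      algebraic_ext (col_module k) (col_space Q) (dual_left Q (dual_right Q M)) \<and>
      free_factor (col_module k) (dual_left Q (dual_right Q M)) M"
    if M: "is_submodule (col_module k) M" "col_space Q \<subseteq> M" for M
  proof -
    have "?col ` {..<m} \<subseteq> col_space Q"
      unfolding col_space_eq dims by (rule R.mod_span_superset) auto
    then have col: "?col ` {..<m} \<subseteq> M" using M(2) by auto
    note dd = R.double_dual[where k=k and M=M and m=m and q="\<lambda>i j. Q $$ (i, j)", OF M(1)[unfolded col_module_eq] col]
    have "dual_left Q (dual_right Q M) = evaluations (*) (evaluations right_mult M m ?col) k ?row"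
      unfolding dual_right[OF M(1) col]
      by (rule dual_left) (use dd(1,2) in \<open>auto simp: row_module_eq\<close>)
    then show ?thesis
      using dd(3,4) R.algebraic_closure_eqI[OF dd(3,4)]
      by (simp add: col_module_eq col_space_eq dims)
  qed
  moreover have "dual_right Q (dual_left Q N) = algebraic_closure (row_module m) (row_space Q) N \<and>
      algebraic_ext (row_module m) (row_space Q) (dual_right Q (dual_left Q N)) \<and>
      free_factor (row_module m) (dual_right Q (dual_left Q N)) N"
    if N: "is_submodule (row_module m) N" "row_space Q \<subseteq> N" for N
  proof -
    have "?row ` {..<k} \<subseteq> row_space Q"
      unfolding row_space_eq dims by (rule L.mod_span_superset) auto
    then have row: "?row ` {..<k} \<subseteq> N" using N(2) by auto
    note dd = L.double_dual[where k=m and M=N and m=k and q="\<lambda>j i. Q $$ (i, j)", OF N(1)[unfolded row_module_eq] row]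
    have "dual_right Q (dual_left Q N) = evaluations right_mult (evaluations (*) N k ?row) m ?col"
      unfolding dual_left[OF N(1) row]
      by (rule dual_right) (use dd(1,2) in \<open>auto simp: col_module_eq\<close>)
    then show ?thesis
      using dd(3,4) L.algebraic_closure_eqI[OF dd(3,4)]
      by (simp add: row_module_eq row_space_eq dims)
  qed
  ultimately show ?thesis by blast
qed

end
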